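(* Let $\{\mathcal{T}(t)\}_{t\ge 0}$ be the asymmetric telegraph process with velocities $c_1,-c_2$ ($c_1,c_2>0$) and rate $\lambda>0$, and let $t>0$. For every integer $k\ge 0$ and every $\beta\in[0,c_1t]$, $$P\Big\{\max_{0\le s\le t}\mathcal{T}(s)<\beta\ \Big|\ V(0)=c_1,\ N(t)=2k+1\Big\}=\sum_{j=0}^{k}\binom{2k+1}{j}\,\frac{(c_1t-\beta)^{j}(c_2t+\beta)^{2k+1-j}-\big(\frac{c_2}{c_1}\big)^{2k+1-2j}(c_1t-\beta)^{2k+1-j}(c_2t+\beta)^{j}}{[(c_1+c_2)t]^{2k+1}}.$$
   Context: Asymmetric telegraph process: let $c_1,c_2>0$, $\lambda>0$. Let $\{N(t)\}_{t\ge0}$ be a homogeneous Poisson process with rate $\lambda$, and let $V(0)$ be a random variable independent of $N$ with $P\{V(0)=c_1\}=P\{V(0)=-c_2\}=\frac12$. The velocity $V(s)$ takes values in $\{c_1,-c_2\}$, starts at $V(0)$, and switches from one of these two values to the other at each event of $N$, remaining constant between events. The position of the particle is $\mathcal{T}(t)=\int_0^t V(s)\,ds$ (so $\mathcal{T}(0)=0$). *)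

theory Defs
  imports "HOL-Probability.Probability"
begin

definition counting_process :: "'a measure \<Rightarrow> (real \<Rightarrow> 'a \<Rightarrow> nat) \<Rightarrow> bool" where
  "counting_process M N \<longleftrightarrow>
     (\<forall>t\<ge>0. N t \<in> measurable M (count_space UNIV)) \<and>
     (\<forall>\<omega>\<in>space M. N 0 \<omega> = 0 \<and>
        mono_on {0..} (\<lambda>t. N t \<omega>) \<and>
        (\<forall>t\<ge>0. continuous (at_right t) (\<lambda>u. N u \<omega>)))"

text \<open>The increments below are differences of natural numbers; since the paths are monotone,
  the truncated subtraction is the true one.\<close>

definition poisson_process :: "'a measure \<Rightarrow> real \<Rightarrow> (real \<Rightarrow> 'a \<Rightarrow> nat) \<Rightarrow> bool" where
  "poisson_process M lam N \<longleftrightarrow>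
     counting_process M N \<and>
     (\<forall>(n::nat) (\<tau>::nat \<Rightarrow> real). 0 \<le> \<tau> 0 \<longrightarrow> strict_mono_on {..n} \<tau> \<longrightarrow>
        prob_space.indep_vars M (\<lambda>_. count_space UNIV)
          (\<lambda>i \<omega>. N (\<tau> (Suc i)) \<omega> - N (\<tau> i) \<omega>) {..<n}) \<and>
     (\<forall>s t. 0 \<le> s \<longrightarrow> s < t \<longrightarrow>
        distr M (count_space UNIV) (\<lambda>\<omega>. N t \<omega> - N s \<omega>) =
        measure_pmf (poisson_pmf (lam * (t - s))))"

text \<open>Independence of a real random variable \<open>X\<close> and the whole process \<open>N\<close>, i.e. of the
  \<open>\<sigma>\<close>-algebras they generate on the sample space. (The library constant \<open>indep_var\<close> is not
  applicable because it requires both variables to have the same value type.)\<close>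

definition indep_of_process :: "'a measure \<Rightarrow> ('a \<Rightarrow> real) \<Rightarrow> (real \<Rightarrow> 'a \<Rightarrow> nat) \<Rightarrow> bool" where
  "indep_of_process M X N \<longleftrightarrow>
     prob_space.indep_set M
       (sets (vimage_algebra (space M) X borel))
       (sets (vimage_algebra (space M) (\<lambda>\<omega>. \<lambda>t\<in>{0..}. N t \<omega>)
          (Pi\<^sub>M {0..} (\<lambda>_. count_space UNIV))))"

definition switch_velocity :: "real \<Rightarrow> real \<Rightarrow> real \<Rightarrow> real" where
  "switch_velocity c\<^sub>1 c\<^sub>2 v = (if v = c\<^sub>1 then - c\<^sub>2 else c\<^sub>1)"

text \<open>At time \<open>s\<close> the initial velocity \<open>V0\<close> has been switched once for each of the \<open>N s\<close>
  events that have occurred.\<close>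

definition telegraph_velocity ::
  "real \<Rightarrow> real \<Rightarrow> ('a \<Rightarrow> real) \<Rightarrow> (real \<Rightarrow> 'a \<Rightarrow> nat) \<Rightarrow> real \<Rightarrow> 'a \<Rightarrow> real" where
  "telegraph_velocity c\<^sub>1 c\<^sub>2 V0 N s \<omega> = (switch_velocity c\<^sub>1 c\<^sub>2 ^^ N s \<omega>) (V0 \<omega>)"

definition telegraph_position ::
  "real \<Rightarrow> real \<Rightarrow> ('a \<Rightarrow> real) \<Rightarrow> (real \<Rightarrow> 'a \<Rightarrow> nat) \<Rightarrow> real \<Rightarrow> 'a \<Rightarrow> real" where
  "telegraph_position c\<^sub>1 c\<^sub>2 V0 N t \<omega> =
     integral {0..t} (\<lambda>s. telegraph_velocity c\<^sub>1 c\<^sub>2 V0 N s \<omega>)"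

end

theory Submission
  imports Defs
begin

text \<open>
  Suppose that a time \<open>\<tau>\<close> remains and that the barrier lies a distance \<open>b\<close> above the
  particle.  The pair \<open>(b, \<tau>)\<close> is replaced by the coordinates
  \<open>p = (c\<^sub>1 \<tau> - b) / (c\<^sub>1 + c\<^sub>2)\<close> and \<open>q = (c\<^sub>2 \<tau> + b) / (c\<^sub>1 + c\<^sub>2)\<close>, so that
  \<open>p + q = \<tau>\<close> and \<open>c\<^sub>1 q - c\<^sub>2 p = b\<close>.  Moving up for a time \<open>s\<close> turns \<open>q\<close> into \<open>q - s\<close> and leaves
  \<open>p\<close> alone; moving down turns \<open>p\<close> into \<open>p - s\<close> and leaves \<open>q\<close> alone.  The particle is at the barrier when
  \<open>c\<^sub>1 q = c\<^sub>2 p\<close>, and once \<open>p \<le> 0\<close> it cannot exceed the barrier in the time that remains.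

  Given \<open>n\<close> jumps, the jump times of a Poisson process are uniform on a simplex, so the probability
  in question is a quotient of volumes.  Let \<open>u\<^sub>k(p, q)\<close> be the volume of the set of ordered
  \<open>2k + 1\<close> jump times for which a path starting upwards stays below the barrier, and \<open>v\<^sub>k(p, q)\<close> the
  volume for \<open>2k\<close> jump times and a path starting downwards.  Splitting at the first jump gives
  \<open>\<partial>u\<^sub>k/\<partial>q = v\<^sub>k\<close> with \<open>u\<^sub>k = 0\<close> on the line \<open>c\<^sub>1 q = c\<^sub>2 p\<close>, and
  \<open>\<partial>v\<^sub>k\<^sub>+\<^sub>1/\<partial>p = u\<^sub>k\<close> with \<open>v\<^sub>k\<^sub>+\<^sub>1 = q\<^bsup>2k+2\<^esup>/(2k+2)!\<close> for \<open>p = 0\<close>.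
  These equations have explicit polynomial solutions, called \<open>up_volume\<close> and \<open>down_volume\<close> below, and
  \<open>u\<^sub>k\<close> divided by the volume \<open>t\<^bsup>2k+1\<^esup>/(2k+1)!\<close> of the whole simplex is the claimed sum
  (\<open>limit_volume_eq\<close>).

  A time grid of mesh \<open>h\<close> connects these polynomials with the process without computing the law of the
  jump times.  Every increment pattern with entries \<open>0\<close> and \<open>1\<close> and sum \<open>n\<close> has the same
  probability, namely \<open>exp (-lam t) (lam h)\<^sup>n\<close>, and the remaining patterns with sum \<open>n\<close> have negligible
  total probability.  The number of favourable patterns satisfies a difference scheme for the above
  differential equations, whence \<open>h\<^sup>n\<close> times this number differs from the polynomial by
  \<open>O(h)\<close> (\<open>scaled_count_approximates\<close>).  On the other hand the true path and the path
  read off from the grid differ by \<open>O(h)\<close>, which encloses the event \<open>max < \<beta>\<close> between two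
  grid events with slightly shifted barriers (\<open>walk_below_subset_max_below\<close>,
  \<open>max_below_subset_walk_below\<close>).  Letting \<open>h\<close> tend to \<open>0\<close> proves the formula
  (\<open>prob_max_below\<close>); the factor \<open>exp (-lam t) lam\<^sup>n / 2\<close> cancels in the conditional probability.
\<close>

section \<open>Lipschitz continuity of polynomial expressions\<close>

lemma lipschitz_on_mult_ex:
  fixes f g :: "'a::metric_space \<Rightarrow> real"
  assumes X: "compact X" and f: "\<exists>L. L-lipschitz_on X f" and g: "\<exists>L. L-lipschitz_on X g"
  shows "\<exists>L. L-lipschitz_on X (\<lambda>x. f x * g x)"
proof -
  from f g obtain L M where L: "L-lipschitz_on X f" and M: "M-lipschitz_on X g" by blast
  have "bounded (f ` X)" "bounded (g ` X)"
    using X L M lipschitz_on_continuous_on compact_continuous_image compact_imp_bounded by blast+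
  then obtain A B where AB: "0 < A" "0 < B" "\<And>x. x \<in> X \<Longrightarrow> \<bar>f x\<bar> \<le> A" "\<And>x. x \<in> X \<Longrightarrow> \<bar>g x\<bar> \<le> B"
    unfolding bounded_pos by (auto simp: real_norm_def)
  have "(A * M + B * L)-lipschitz_on X (\<lambda>x. f x * g x)"
  proof (rule lipschitz_onI)
    fix x y assume xy: "x \<in> X" "y \<in> X"
    have "f x * g x - f y * g y = f x * (g x - g y) + (f x - f y) * g y"
      by (simp add: algebra_simps)
    also have "\<bar>\<dots>\<bar> \<le> \<bar>f x\<bar> * \<bar>g x - g y\<bar> + \<bar>f x - f y\<bar> * \<bar>g y\<bar>"
      by (metis abs_mult abs_triangle_ineq)
    also have "\<dots> \<le> A * (M * dist x y) + (L * dist x y) * B"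
      using AB xy lipschitz_onD[OF L xy] lipschitz_onD[OF M xy]
      by (intro add_mono mult_mono) (auto simp: dist_real_def)
    finally show "dist (f x * g x) (f y * g y) \<le> (A * M + B * L) * dist x y"
      by (simp add: dist_real_def algebra_simps)
  qed (use AB lipschitz_on_nonneg[OF L] lipschitz_on_nonneg[OF M] in auto)
  then show ?thesis by blast
qed

lemma lipschitz_on_power_ex:
  fixes f :: "'a::metric_space \<Rightarrow> real"
  assumes "compact X" and "\<exists>L. L-lipschitz_on X f"
  shows "\<exists>L. L-lipschitz_on X (\<lambda>x. f x ^ n)"
proof (induction n)
  case 0
  then show ?case using lipschitz_on_constant[of X "1::real"] by auto
next
  case (Suc n)
  then show ?case using lipschitz_on_mult_ex[OF assms] by simp
qed

lemma lipschitz_on_sum_ex: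
  fixes f :: "'i \<Rightarrow> 'a::metric_space \<Rightarrow> real"
  assumes "\<And>i. i \<in> I \<Longrightarrow> \<exists>L. L-lipschitz_on X (f i)"
  shows "\<exists>L. L-lipschitz_on X (\<lambda>x. \<Sum>i\<in>I. f i x)"
  using assms
proof (induction I rule: infinite_finite_induct)
  case (insert i I)
  from insert obtain L M where "L-lipschitz_on X (f i)" "M-lipschitz_on X (\<lambda>x. \<Sum>i\<in>I. f i x)"
    by blast
  then have "(L + M)-lipschitz_on X (\<lambda>x. f i x + (\<Sum>i\<in>I. f i x))"
    by (rule lipschitz_on_add)
  then show ?case using insert.hyps by auto
qed (auto intro: exI[of _ 0] lipschitz_on_constant)

section \<open>The volumes of the sets of favourable jump times\<close>

text \<open>
  The volume of the ordered \<open>n\<close>-tuples in \<open>[0, x]\<close>; with this normalisation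
  differentiation just lowers the index.
\<close>
definition divided_power :: "nat \<Rightarrow> real \<Rightarrow> real" where
  "divided_power n x = x ^ n / fact n"

lemma divided_power_simps [simp]:
  "divided_power 0 x = 1" "divided_power (Suc n) 0 = 0"
  by (auto simp: divided_power_def)

lemma DERIV_divided_power_Suc:
  "(divided_power (Suc n) has_real_derivative divided_power n x) (at x)"
proof -
  have "((\<lambda>x. x ^ Suc n / fact (Suc n)) has_real_derivative (real (Suc n) * x ^ n) / fact (Suc n)) (at x)"
    by (intro DERIV_cdivide) (use DERIV_pow[of "Suc n" x] in simp)
  then show ?thesis by (simp add: divided_power_def[abs_def] del: of_nat_Suc)
qed

lemma DERIV_divided_power:
  assumes "n > 0" shows "(divided_power n has_real_derivative divided_power (n-1) x) (at x)"
  using assms DERIV_divided_power_Suc[of "n-1" x] by simp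

text \<open>
  The volumes \<open>u\<^sub>k\<close> and \<open>v\<^sub>k\<close> of the introduction, with \<open>r = c\<^sub>2 / c\<^sub>1\<close>.  In each, the second
  family of terms is a reflected copy of the first, with the roles of \<open>p\<close> and \<open>q\<close> exchanged; its powers
  of \<open>r\<close> are those that make \<open>u\<^sub>k\<close> vanish on the line \<open>q = r p\<close>.
\<close>
definition up_volume :: "real \<Rightarrow> nat \<Rightarrow> real \<Rightarrow> real \<Rightarrow> real" where
  "up_volume r k p q = (\<Sum>j\<le>k. divided_power j p * divided_power (2*k+1-j) q
      - r ^ (2*k+1-2*j) * divided_power (2*k+1-j) p * divided_power j q)"

definition down_volume :: "real \<Rightarrow> nat \<Rightarrow> real \<Rightarrow> real \<Rightarrow> real" where
  "down_volume r k p q = (\<Sum>j\<le>k. divided_power j p * divided_power (2*k-j) q)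
      - (\<Sum>j<k. r ^ (2*k-1-2*j) * divided_power (2*k-j) p * divided_power j q)"

text \<open>
  The infinitesimal form of conditioning on the time of the first jump of a path that starts upwards;
  \<open>down_volume_Suc_deriv\<close> does the same for a start downwards.
\<close>
lemma up_volume_deriv:
  "((\<lambda>q. up_volume r k p q) has_real_derivative down_volume r k p q) (at q)"
proof -
  have A: "((\<lambda>q. \<Sum>j\<le>k. divided_power j p * divided_power (2*k+1-j) q) has_real_derivative
     (\<Sum>j\<le>k. divided_power j p * divided_power (2*k-j) q)) (at q)"
  proof (intro DERIV_sum DERIV_cmult)
    fix j assume "j \<in> {..k}"
    then have "2*k+1-j > 0" "2*k+1-j-1 = 2*k-j" by auto
    then show "(divided_power (2*k+1-j) has_real_derivative divided_power (2*k-j) q) (at q)"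
      using DERIV_divided_power by metis
  qed
  have B: "((\<lambda>q. \<Sum>j<k. r ^ (2*k-1-2*j) * divided_power (2*k-j) p * divided_power (Suc j) q)
     has_real_derivative (\<Sum>j<k. r ^ (2*k-1-2*j) * divided_power (2*k-j) p * divided_power j q)) (at q)"
    by (intro DERIV_sum DERIV_cmult DERIV_divided_power_Suc)
  \<comment> \<open>the reflected term with \<open>j = 0\<close> does not depend on \<open>q\<close>\<close>
  have "up_volume r k p q = (\<Sum>j\<le>k. divided_power j p * divided_power (2*k+1-j) q)
     - (\<Sum>j<k. r ^ (2*k-1-2*j) * divided_power (2*k-j) p * divided_power (Suc j) q)
     - r ^ (2*k+1) * divided_power (2*k+1) p" for q
    unfolding up_volume_def sum_subtractf
    by (subst (2) sum.atMost_shift) simp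
  then show ?thesis unfolding down_volume_def
    using DERIV_diff[OF DERIV_diff[OF A B] DERIV_const[of "r ^ (2*k+1) * divided_power (2*k+1) p"]]
    by simp
qed

lemma down_volume_Suc_deriv:
  "((\<lambda>p. down_volume r (Suc k) p q) has_real_derivative up_volume r k p q) (at p)"
proof -
  have A: "((\<lambda>p. \<Sum>j\<le>k. divided_power (Suc j) p * divided_power (2*k+1-j) q) has_real_derivative
     (\<Sum>j\<le>k. divided_power j p * divided_power (2*k+1-j) q)) (at p)"
    by (intro DERIV_sum DERIV_cmult_right DERIV_divided_power_Suc)
  have B: "((\<lambda>p. \<Sum>j\<le>k. r ^ (2*k+1-2*j) * divided_power (2*k+2-j) p * divided_power j q)
     has_real_derivative (\<Sum>j\<le>k. r ^ (2*k+1-2*j) * divided_power (2*k+1-j) p * divided_power j q)) (at p)"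
  proof (intro DERIV_sum DERIV_cmult_right DERIV_cmult)
    fix j assume "j \<in> {..k}"
    then have "2*k+2-j > 0" "2*k+2-j-1 = 2*k+1-j" by auto
    then show "(divided_power (2*k+2-j) has_real_derivative divided_power (2*k+1-j) p) (at p)"
      using DERIV_divided_power by metis
  qed
  have "down_volume r (Suc k) p q = divided_power (2*k+2) q
       + (\<Sum>j\<le>k. divided_power (Suc j) p * divided_power (2*k+1-j) q)
       - (\<Sum>j\<le>k. r ^ (2*k+1-2*j) * divided_power (2*k+2-j) p * divided_power j q)" for p
    unfolding down_volume_def sum.atMost_shift[of _ "Suc k"] by (simp add: lessThan_Suc_atMost)
  then show ?thesis unfolding up_volume_def sum_subtractf
    using DERIV_diff[OF DERIV_add[OF DERIV_const[of "divided_power (2*k+2) q"] A] B]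
    by simp
qed

lemma down_volume_0 [simp]: "down_volume r 0 p q = 1"
  by (simp add: down_volume_def)

text \<open>
  A path that starts downwards with \<open>p = 0\<close> can no longer reach the barrier, so the volume is that of
  the whole simplex.
\<close>
lemma down_volume_at_0: "down_volume r k 0 q = divided_power (2*k) q"
proof -
  have "(\<Sum>j\<le>k. divided_power j 0 * divided_power (2*k-j) q) = (\<Sum>j\<in>{0}. divided_power j 0 * divided_power (2*k-j) q)"
    by (rule sum.mono_neutral_right) (auto simp: divided_power_def)
  moreover have "(\<Sum>j<k. r ^ (2*k-1-2*j) * divided_power (2*k-j) 0 * divided_power j q) = 0"
    by (rule sum.neutral) (auto simp: divided_power_def)
  ultimately show ?thesis by (simp add: down_volume_def)
qed

text \<open>
  A path that starts upwards at the barrier crosses it at once.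
\<close>
lemma up_volume_eq_0: "up_volume r k p (r * p) = 0"
proof -
  have "divided_power j p * divided_power (2*k+1-j) (r * p)
      = r ^ (2*k+1-2*j) * divided_power (2*k+1-j) p * divided_power j (r * p)" if "j \<le> k" for j
  proof -
    have "r ^ (2*k+1-j) = r ^ (2*k+1-2*j) * r ^ j"
      unfolding power_add[symmetric] using that by (intro arg_cong[of _ _ "power r"]) simp
    then show ?thesis by (simp add: divided_power_def power_mult_distrib mult_ac)
  qed
  then show ?thesis by (simp add: up_volume_def)
qed

lemma lipschitz_divided_power_ex:
  assumes "compact X" and "\<exists>L. L-lipschitz_on X f"
  shows "\<exists>L. L-lipschitz_on X (\<lambda>x. divided_power n (f x))"
  using lipschitz_on_mult_ex[OF assms(1) lipschitz_on_power_ex[OF assms, of n], of "\<lambda>_. inverse (fact n)"]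
    lipschitz_on_constant[of X "inverse (fact n) :: real"]
  unfolding divided_power_def divide_inverse by blast

lemma lipschitz_square:
  assumes "\<exists>L. L-lipschitz_on ({0..T} \<times> {0..T}) (\<lambda>x. f (fst x) (snd x))"
  obtains L where "0 \<le> (L::real)"
    and "\<And>p q q'. p \<in> {0..T} \<Longrightarrow> q \<in> {0..T} \<Longrightarrow> q' \<in> {0..T} \<Longrightarrow> \<bar>f p q - f p q'\<bar> \<le> L * \<bar>q - q'\<bar>"
    and "\<And>p p' q. p \<in> {0..T} \<Longrightarrow> q \<in> {0..T} \<Longrightarrow> p' \<in> {0..T} \<Longrightarrow> \<bar>f p q - f p' q\<bar> \<le> L * \<bar>p - p'\<bar>"
proof -
  from assms obtain L where L: "L-lipschitz_on ({0..T} \<times> {0..T}) (\<lambda>x. f (fst x) (snd x))" by blast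
  show thesis
  proof (rule that[of L])
    show "0 \<le> L" using L by (rule lipschitz_on_nonneg)
    show "\<bar>f p q - f p q'\<bar> \<le> L * \<bar>q - q'\<bar>" if "p \<in> {0..T}" "q \<in> {0..T}" "q' \<in> {0..T}" for p q q'
      using lipschitz_onD[OF L, of "(p,q)" "(p,q')"] that by (auto simp: dist_real_def dist_Pair_Pair)
    show "\<bar>f p q - f p' q\<bar> \<le> L * \<bar>p - p'\<bar>" if "p \<in> {0..T}" "q \<in> {0..T}" "p' \<in> {0..T}" for p p' q
      using lipschitz_onD[OF L, of "(p,q)" "(p',q)"] that by (auto simp: dist_real_def dist_Pair_Pair)
  qed
qed

text \<open>
  These constants control the local error of the difference scheme.
\<close>
lemma lipschitz_volumes:
  fixes T :: real
  shows "\<exists>L. L-lipschitz_on ({0..T} \<times> {0..T}) (\<lambda>x. up_volume r k (fst x) (snd x))" (is ?U)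
    and "\<exists>L. L-lipschitz_on ({0..T} \<times> {0..T}) (\<lambda>x. down_volume r k (fst x) (snd x))" (is ?D)
proof -
  let ?X = "{0..T} \<times> {0..T}"
  have X: "compact ?X" by (intro compact_Times) auto
  have "1-lipschitz_on ?X fst" "1-lipschitz_on ?X snd"
    by (rule lipschitz_onI; simp add: dist_fst_le dist_snd_le)+
  then have fst: "\<exists>L. L-lipschitz_on ?X fst" and snd: "\<exists>L. L-lipschitz_on ?X snd" by blast+
  have diff: "\<exists>L. L-lipschitz_on ?X (\<lambda>x. f x - g x)"
    if "\<exists>L. L-lipschitz_on ?X f" "\<exists>L. L-lipschitz_on ?X g" for f g :: "real \<times> real \<Rightarrow> real"
    using that lipschitz_on_diff by blast
  have const: "\<exists>L. L-lipschitz_on ?X (\<lambda>x. c)" for c :: real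
    using lipschitz_on_constant by blast
  show ?U unfolding up_volume_def
    by (intro lipschitz_on_sum_ex diff lipschitz_on_mult_ex lipschitz_divided_power_ex X fst snd const)
  show ?D unfolding down_volume_def
    by (intro lipschitz_on_sum_ex diff lipschitz_on_mult_ex lipschitz_divided_power_ex X fst snd const)
qed

section \<open>Counting the favourable jump patterns of a grid walk\<close>

text \<open>
  The list gives the numbers of jumps in successive cells of a time grid, \<open>b\<close> is the distance of the
  particle from the barrier, and \<open>rise\<close> and \<open>fall\<close> are the distances covered in one cell.  The
  jumps of a cell take effect at its end, so within a cell the walk has the velocity with which it enters.
\<close>
primrec stays_below :: "real \<Rightarrow> real \<Rightarrow> bool \<Rightarrow> real \<Rightarrow> nat list \<Rightarrow> bool" where
  "stays_below rise fall up b [] \<longleftrightarrow> 0 < b"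
| "stays_below rise fall up b (x # xs) \<longleftrightarrow> 0 < b \<and>
     stays_below rise fall (up = even x) (if up then b - rise else b + fall) xs"

lemma stays_below_pos: "stays_below rise fall up b xs \<Longrightarrow> 0 < b"
  by (cases xs) auto

lemma stays_below_if_far:
  assumes "0 \<le> rise" "0 \<le> fall" and "rise * real (length xs) < b"
  shows "stays_below rise fall up b xs"
  using assms(3)
proof (induction xs arbitrary: up b)
  case (Cons x xs)
  have "0 \<le> rise * real (length xs)" using assms by simp
  moreover have "rise + rise * real (length xs) < b"
    using Cons.prems by (simp add: algebra_simps)
  ultimately have "0 < b" "rise * real (length xs) < b - rise" "rise * real (length xs) < b + fall"
    using assms(1,2) by linarith+
  then show ?case using Cons.IH by simp
qed auto

text \<open>
  Patterns without multiple jumps in a cell; on the others the Poisson weights are not all equal,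
  but they are negligible in the limit.
\<close>
definition jump_patterns :: "nat \<Rightarrow> nat \<Rightarrow> nat list set" where
  "jump_patterns m n = {xs. length xs = m \<and> set xs \<subseteq> {0, 1} \<and> sum_list xs = n}"

lemma jump_patterns_0: "jump_patterns 0 n = (if n = 0 then {[]} else {})"
  by (auto simp: jump_patterns_def)

lemma jump_patterns_Suc_0: "jump_patterns (Suc m) 0 = (#) 0 ` jump_patterns m 0"
  by (auto simp: jump_patterns_def length_Suc_conv image_iff)

lemma jump_patterns_Suc_Suc:
  "jump_patterns (Suc m) (Suc n) = (#) 0 ` jump_patterns m (Suc n) \<union> (#) 1 ` jump_patterns m n"
  by (auto simp: jump_patterns_def length_Suc_conv image_iff)

lemma finite_jump_patterns [simp]: "finite (jump_patterns m n)"
  by (rule finite_subset[OF _ finite_lists_length_eq[of "{0,1}" m]]) (auto simp: jump_patterns_def)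

lemma card_jump_patterns_Suc_Suc:
  "card {xs \<in> jump_patterns (Suc m) (Suc n). Q xs}
     = card {xs \<in> jump_patterns m (Suc n). Q (0 # xs)} + card {xs \<in> jump_patterns m n. Q (1 # xs)}"
proof -
  have "{xs \<in> jump_patterns (Suc m) (Suc n). Q xs}
      = (#) 0 ` {xs \<in> jump_patterns m (Suc n). Q (0 # xs)} \<union> (#) 1 ` {xs \<in> jump_patterns m n. Q (1 # xs)}"
    by (auto simp: jump_patterns_Suc_Suc)
  also have "card \<dots> = card ((#) (0::nat) ` {xs \<in> jump_patterns m (Suc n). Q (0 # xs)})
      + card ((#) (1::nat) ` {xs \<in> jump_patterns m n. Q (1 # xs)})"
    by (intro card_Un_disjoint) auto
  finally show ?thesis by (simp add: card_image)
qed

lemma card_jump_patterns: "card (jump_patterns m n) = m choose n"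
proof (induction m arbitrary: n)
  case (Suc m)
  show ?case
  proof (cases n)
    case 0
    then show ?thesis using Suc[of 0] by (simp add: jump_patterns_Suc_0 card_image)
  next
    case (Suc n')
    then show ?thesis using Suc.IH card_jump_patterns_Suc_Suc[of m n' "\<lambda>_. True"] by simp
  qed
qed (auto simp: jump_patterns_0)

text \<open>
  The discretisation error for the volume of the whole simplex.  It is needed twice: for walks that can no
  longer reach the barrier, and to bound the probability of several jumps in one cell.
\<close>
lemma binomial_approx_divided_power:
  assumes "0 \<le> T"
  shows "\<exists>K\<ge>0. \<forall>h m. 0 \<le> h \<longrightarrow> real m * h \<le> T \<longrightarrow>
     \<bar>h ^ n * real (m choose n) - divided_power n (real m * h)\<bar> \<le> K * h"
proof (induction n)
  case 0
  show ?case by (intro exI[of _ 0]) simp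
next
  case (Suc n)
  then obtain K where K: "K \<ge> 0" "\<And>h m. 0 \<le> h \<Longrightarrow> real m * h \<le> T \<Longrightarrow>
     \<bar>h ^ n * real (m choose n) - divided_power n (real m * h)\<bar> \<le> K * h" by blast
  show ?case
  proof (intro exI[of _ "T * K + n * T ^ n"] conjI allI impI)
    show "0 \<le> T * K + n * T ^ n" using assms K by simp
    fix h :: real and m :: nat
    assume h: "0 \<le> h" "real m * h \<le> T"
    let ?x = "\<lambda>n. h ^ n * real (m choose n)" and ?y = "\<lambda>n. divided_power n (real m * h)"
    \<comment> \<open>the approximation and its limit satisfy nearly the same recursion in \<open>n\<close>\<close>
    have "real ((m - n) * (m choose n)) = real (Suc n * (m choose Suc n))"
      using binomial_absorb_comp[of m n] binomial_absorption[of n m] by simp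
    then have "(real m - real n) * real (m choose n) = real (Suc n) * real (m choose Suc n)"
      unfolding of_nat_mult by (cases "n \<le> m") (simp_all add: of_nat_diff binomial_eq_0 not_le)
    then have x: "real (Suc n) * ?x (Suc n) = h * (real m - real n) * ?x n"
      by (simp add: algebra_simps del: of_nat_Suc)
    have y: "real (Suc n) * ?y (Suc n) = real m * h * ?y n"
      by (simp add: divided_power_def field_simps del: of_nat_Suc)
    have eq: "real (Suc n) * (?x (Suc n) - ?y (Suc n)) = real m * h * (?x n - ?y n) - real n * h * ?x n"
      unfolding right_diff_distrib x y by (simp add: algebra_simps)
    have "?x n \<le> T ^ n"
    proof (cases "n \<le> m")
      case True
      have "?x n \<le> h ^ n * real m ^ n"
        using binomial_le_pow[OF True] h
        by (intro mult_left_mono) (auto simp flip: of_nat_power)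
      also have "\<dots> = (real m * h) ^ n" by (simp add: power_mult_distrib)
      also have "\<dots> \<le> T ^ n" using h by (intro power_mono) auto
      finally show ?thesis .
    next
      case False then show ?thesis using assms by (simp add: binomial_eq_0)
    qed
    then have "\<bar>real n * h * ?x n\<bar> \<le> real n * h * T ^ n"
      using h by (simp add: abs_mult mult_left_mono)
    moreover have "\<bar>real m * h * (?x n - ?y n)\<bar> \<le> T * (K * h)"
      unfolding abs_mult[of "real m * h"] using K(2)[OF h] h assms
      by (intro mult_mono) auto
    ultimately have "\<bar>real (Suc n) * (?x (Suc n) - ?y (Suc n))\<bar> \<le> (T * K + n * T ^ n) * h"
      unfolding eq by (simp add: algebra_simps)
    moreover have "\<bar>?x (Suc n) - ?y (Suc n)\<bar> \<le> \<bar>real (Suc n) * (?x (Suc n) - ?y (Suc n))\<bar>"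
      unfolding abs_mult using mult_right_mono[of 1 "real (Suc n)" "\<bar>?x (Suc n) - ?y (Suc n)\<bar>"] by simp
    ultimately show "\<bar>?x (Suc n) - ?y (Suc n)\<bar> \<le> (T * K + n * T ^ n) * h" by linarith
  qed
qed

text \<open>
  The factor \<open>h\<^sup>n\<close> is the volume represented by one pattern with \<open>n\<close> jumps.
\<close>
definition scaled_count :: "real \<Rightarrow> real \<Rightarrow> real \<Rightarrow> bool \<Rightarrow> nat \<Rightarrow> nat \<Rightarrow> real \<Rightarrow> real" where
  "scaled_count c\<^sub>1 c\<^sub>2 h up n m b
     = h ^ n * real (card {xs \<in> jump_patterns m n. stays_below (c\<^sub>1 * h) (c\<^sub>2 * h) up b xs})"

lemma scaled_count_nonpos: "b \<le> 0 \<Longrightarrow> scaled_count c\<^sub>1 c\<^sub>2 h up n m b = 0"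
  using stays_below_pos[of "c\<^sub>1 * h" "c\<^sub>2 * h" up b] by (force simp: scaled_count_def)

text \<open>
  Splitting by the first cell gives a difference scheme for the equations satisfied by
  \<open>up_volume\<close> and \<open>down_volume\<close>.
\<close>
lemma scaled_count_Suc:
  assumes "0 < b"
  shows "scaled_count c\<^sub>1 c\<^sub>2 h True (Suc n) (Suc m) b = scaled_count c\<^sub>1 c\<^sub>2 h True (Suc n) m (b - c\<^sub>1 * h)
            + h * scaled_count c\<^sub>1 c\<^sub>2 h False n m (b - c\<^sub>1 * h)"
    and "scaled_count c\<^sub>1 c\<^sub>2 h False (Suc n) (Suc m) b = scaled_count c\<^sub>1 c\<^sub>2 h False (Suc n) m (b + c\<^sub>2 * h)
            + h * scaled_count c\<^sub>1 c\<^sub>2 h True n m (b + c\<^sub>2 * h)"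
  using assms unfolding scaled_count_def card_jump_patterns_Suc_Suc
  by (simp_all add: algebra_simps)

lemma scaled_count_free:
  assumes "0 \<le> c\<^sub>1" "0 \<le> c\<^sub>2" "0 \<le> h" "c\<^sub>1 * (real m * h) < b"
  shows "scaled_count c\<^sub>1 c\<^sub>2 h up n m b = h ^ n * real (m choose n)"
proof -
  have "{xs \<in> jump_patterns m n. stays_below (c\<^sub>1 * h) (c\<^sub>2 * h) up b xs} = jump_patterns m n"
    using assms by (auto simp: jump_patterns_def mult_ac intro!: stays_below_if_far)
  then show ?thesis by (simp add: scaled_count_def card_jump_patterns)
qed

text \<open>
  The start of the alternating induction: without jumps a walk that starts downwards is never stopped.
\<close>
lemma scaled_count_no_jump:
  assumes "0 \<le> c\<^sub>2" "0 \<le> h" "0 < b"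
  shows "scaled_count c\<^sub>1 c\<^sub>2 h False 0 m b = 1"
proof -
  have "card {xs \<in> jump_patterns m 0. stays_below (c\<^sub>1 * h) (c\<^sub>2 * h) False b xs} = 1"
    using \<open>0 < b\<close>
  proof (induction m arbitrary: b)
    case 0
    then show ?case by (simp add: jump_patterns_0 Collect_conv_if cong: conj_cong)
  next
    case (Suc m)
    have "{xs \<in> jump_patterns (Suc m) 0. stays_below (c\<^sub>1 * h) (c\<^sub>2 * h) False b xs}
       = (#) 0 ` {xs \<in> jump_patterns m 0. stays_below (c\<^sub>1 * h) (c\<^sub>2 * h) False (b + c\<^sub>2 * h) xs}"
      using Suc.prems by (auto simp: jump_patterns_Suc_0)
    moreover have "0 < b + c\<^sub>2 * h" using assms Suc.prems by (intro add_pos_nonneg) auto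
    ultimately show ?case using Suc.IH by (simp add: card_image)
  qed
  then show ?thesis by (simp add: scaled_count_def)
qed

text \<open>
  The scaled counts converge to \<open>f\<close> at rate \<open>O(h)\<close>, uniformly over the positions with \<open>p \<ge> 0\<close>
  below the barrier and over the remaining times up to \<open>T\<close>.
\<close>
definition approximates ::
  "real \<Rightarrow> real \<Rightarrow> real \<Rightarrow> bool \<Rightarrow> nat \<Rightarrow> (real \<Rightarrow> real \<Rightarrow> real) \<Rightarrow> bool" where
  "approximates c\<^sub>1 c\<^sub>2 T up n f \<longleftrightarrow> (\<exists>K\<ge>0. \<forall>h>0. \<forall>m p q. 0 \<le> p \<longrightarrow> p + q = real m * h \<longrightarrow>
     real m * h \<le> T \<longrightarrow> 0 < c\<^sub>1 * q - c\<^sub>2 * p \<longrightarrow>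
     \<bar>scaled_count c\<^sub>1 c\<^sub>2 h up n m (c\<^sub>1 * q - c\<^sub>2 * p) - f p q\<bar> \<le> K * h)"

text \<open>
  One cell replaces \<open>q\<close> by \<open>q - h\<close>.  The local error is \<open>O(h\<^sup>2)\<close>: it is \<open>h\<close> times the error of the
  counts with one jump less, plus the error of the one-sided difference quotient for \<open>up_volume\<close>.  Over at
  most \<open>T / h\<close> cells this sums up to \<open>O(h)\<close>.  When the walk would reach the barrier in the next cell the count
  is zero, and the volume is \<open>O(h)\<close> because it vanishes at the barrier.
\<close>
lemma up_step:
  assumes c: "0 < c\<^sub>1" "0 < c\<^sub>2"
    and down: "approximates c\<^sub>1 c\<^sub>2 T False (2*k) (down_volume (c\<^sub>2/c\<^sub>1) k)"
  shows "approximates c\<^sub>1 c\<^sub>2 T True (2*k+1) (up_volume (c\<^sub>2/c\<^sub>1) k)"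
proof -
  let ?u = "up_volume (c\<^sub>2/c\<^sub>1) k" and ?v = "down_volume (c\<^sub>2/c\<^sub>1) k"
  let ?U = "\<lambda>h m b. scaled_count c\<^sub>1 c\<^sub>2 h True (2*k+1) m b"
  let ?V = "\<lambda>h m b. scaled_count c\<^sub>1 c\<^sub>2 h False (2*k) m b"
  obtain K where K: "K \<ge> 0" "\<And>h m p q. h > 0 \<Longrightarrow> 0 \<le> p \<Longrightarrow> p + q = real m * h \<Longrightarrow>
     real m * h \<le> T \<Longrightarrow> 0 < c\<^sub>1 * q - c\<^sub>2 * p \<Longrightarrow> \<bar>?V h m (c\<^sub>1 * q - c\<^sub>2 * p) - ?v p q\<bar> \<le> K * h"
    using down unfolding approximates_def by blast
  obtain L where L: "L \<ge> 0"
    "\<And>p q q'. p \<in> {0..T} \<Longrightarrow> q \<in> {0..T} \<Longrightarrow> q' \<in> {0..T} \<Longrightarrow> \<bar>?v p q - ?v p q'\<bar> \<le> L * \<bar>q - q'\<bar>"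
    using lipschitz_square[OF lipschitz_volumes(2)] by metis
  obtain M where M: "M \<ge> 0"
    "\<And>p q q'. p \<in> {0..T} \<Longrightarrow> q \<in> {0..T} \<Longrightarrow> q' \<in> {0..T} \<Longrightarrow> \<bar>?u p q - ?u p q'\<bar> \<le> M * \<bar>q - q'\<bar>"
    using lipschitz_square[OF lipschitz_volumes(1)] by metis
  have main: "\<bar>?U h m (c\<^sub>1 * q - c\<^sub>2 * p) - ?u p q\<bar> \<le> ((K + L) * (real m * h) + M) * h"
    if "h > 0" "0 \<le> p" "p + q = real m * h" "real m * h \<le> T" "0 < c\<^sub>1 * q - c\<^sub>2 * p" for h m p q
    using that
  proof (induction m arbitrary: p q)
    case 0
    \<comment> \<open>no time remains: \<open>q = -p \<le> 0\<close> contradicts the position below the barrier\<close>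
    then have "q \<le> 0" by simp
    then have "c\<^sub>1 * q \<le> 0" "0 \<le> c\<^sub>2 * p" using c 0 by (auto simp: mult_le_0_iff)
    then show ?case using 0 by linarith
  next
    case (Suc m)
    \<comment> \<open>below the barrier, \<open>p \<ge> 0\<close> forces \<open>q > 0\<close>, so \<open>(p, q)\<close> lies in the square \<open>[0, T]\<^sup>2\<close>\<close>
    have q: "0 < q"
      using Suc.prems(2,5) c by (smt (verit) mult_nonneg_nonneg mult_le_0_iff)
    have p: "p \<le> T" "q \<le> T" using Suc.prems q by auto
    show ?case
    proof (cases "c\<^sub>1 * q - c\<^sub>2 * p \<le> c\<^sub>1 * h")
      case True
      have "?U h (Suc m) (c\<^sub>1 * q - c\<^sub>2 * p) = 0"
        using scaled_count_Suc(1)[OF Suc.prems(5), of c\<^sub>1 c\<^sub>2 h "2*k" m] True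
        by (simp add: scaled_count_nonpos)
      moreover have "\<bar>?u p q\<bar> \<le> M * h"
      proof -
        \<comment> \<open>the point of the barrier with the same \<open>p\<close>\<close>
        let ?q = "c\<^sub>2 / c\<^sub>1 * p"
        have "0 \<le> q - ?q" "q - ?q \<le> h" "0 \<le> ?q" using True Suc.prems c by (auto simp: field_simps)
        then have "\<bar>?u p q - ?u p ?q\<bar> \<le> M * \<bar>q - ?q\<bar>"
          by (intro M(2)) (use Suc.prems(2) p q in auto)
        also have "\<dots> \<le> M * h" using \<open>0 \<le> q - ?q\<close> \<open>q - ?q \<le> h\<close> M by (intro mult_left_mono) auto
        finally show ?thesis by (simp only: up_volume_eq_0)
      qed
      moreover have "0 \<le> (K + L) * (real (Suc m) * h) * h" using K L Suc.prems by simp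
      ultimately show ?thesis by (simp add: algebra_simps del: of_nat_Suc)
    next
      case False
      let ?b = "c\<^sub>1 * (q - h) - c\<^sub>2 * p"
      have b: "?b = c\<^sub>1 * q - c\<^sub>2 * p - c\<^sub>1 * h" "0 < ?b" using False by (auto simp: algebra_simps)
      have mh: "p + (q - h) = real m * h" "real m * h \<le> T"
        using Suc.prems by (auto simp: algebra_simps)
      have q': "0 < q - h"
        using Suc.prems(2) b(2) c by (smt (verit) mult_nonneg_nonneg mult_le_0_iff)
      have IH: "\<bar>?U h m ?b - ?u p (q - h)\<bar> \<le> ((K + L) * (real m * h) + M) * h"
        using Suc.IH Suc.prems b mh by blast
      have V: "\<bar>?V h m ?b - ?v p (q - h)\<bar> \<le> K * h"
        using K(2) Suc.prems b mh by blast
      obtain \<xi> where \<xi>: "q - h < \<xi>" "\<xi> < q" "?u p q - ?u p (q - h) = h * ?v p \<xi>"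
        using MVT2[of "q - h" q "?u p" "?v p"] up_volume_deriv Suc.prems(1) by force
      have "\<bar>?v p \<xi> - ?v p (q - h)\<bar> \<le> L * \<bar>\<xi> - (q - h)\<bar>"
        by (intro L(2)) (use p q q' \<xi> Suc.prems(2) in auto)
      also have "\<dots> \<le> L * h" using \<xi> L by (intro mult_left_mono) auto
      finally have v: "\<bar>?v p \<xi> - ?v p (q - h)\<bar> \<le> L * h" .
      have "?U h (Suc m) (c\<^sub>1 * q - c\<^sub>2 * p) = ?U h m ?b + h * ?V h m ?b"
        using scaled_count_Suc(1)[OF Suc.prems(5), of c\<^sub>1 c\<^sub>2 h "2*k" m]
        unfolding b(1)[symmetric] by simp
      then have "?U h (Suc m) (c\<^sub>1 * q - c\<^sub>2 * p) - ?u p q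
         = (?U h m ?b - ?u p (q - h)) + h * ((?V h m ?b - ?v p (q - h)) - (?v p \<xi> - ?v p (q - h)))"
        using \<xi>(3) by (simp add: algebra_simps)
      also have "\<bar>\<dots>\<bar> \<le> ((K + L) * (real m * h) + M) * h + h * (K * h + L * h)"
      proof -
        have "\<bar>h * ((?V h m ?b - ?v p (q - h)) - (?v p \<xi> - ?v p (q - h)))\<bar> \<le> h * (K * h + L * h)"
          unfolding abs_mult using V v Suc.prems(1) by (intro mult_mono) auto
        then show ?thesis using IH by linarith
      qed
      finally show ?thesis by (simp add: algebra_simps)
    qed
  qed
  show ?thesis unfolding approximates_def
  proof (intro exI[of _ "(K + L) * max T 0 + M"] conjI allI impI)
    show "0 \<le> (K + L) * max T 0 + M" using K L M by simp
    fix h :: real and m p q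
    assume a: "0 < h" "0 \<le> p" "p + q = real m * h" "real m * h \<le> T" "0 < c\<^sub>1 * q - c\<^sub>2 * p"
    have "(K + L) * (real m * h) \<le> (K + L) * max T 0" using K L a by (intro mult_left_mono) auto
    then have "((K + L) * (real m * h) + M) * h \<le> ((K + L) * max T 0 + M) * h"
      using a by (intro mult_right_mono) auto
    then show "\<bar>?U h m (c\<^sub>1 * q - c\<^sub>2 * p) - ?u p q\<bar> \<le> ((K + L) * max T 0 + M) * h"
      using main[OF a] by linarith
  qed
qed

text \<open>
  As in \<open>up_step\<close>, with one cell replacing \<open>p\<close> by \<open>p - h\<close>.  The recursion now ends when \<open>p < h\<close>:
  after one more cell the barrier is out of reach, all patterns are favourable, and the count
  is a binomial coefficient.
\<close>
lemma down_step:
  assumes c: "0 < c\<^sub>1" "0 < c\<^sub>2" and T: "0 \<le> T"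
    and up: "approximates c\<^sub>1 c\<^sub>2 T True (2*k+1) (up_volume (c\<^sub>2/c\<^sub>1) k)"
  shows "approximates c\<^sub>1 c\<^sub>2 T False (2 * Suc k) (down_volume (c\<^sub>2/c\<^sub>1) (Suc k))"
proof -
  let ?u = "up_volume (c\<^sub>2/c\<^sub>1) k" and ?v = "down_volume (c\<^sub>2/c\<^sub>1) (Suc k)"
  let ?U = "\<lambda>h m b. scaled_count c\<^sub>1 c\<^sub>2 h True (2*k+1) m b"
  let ?V = "\<lambda>h m b. scaled_count c\<^sub>1 c\<^sub>2 h False (2 * Suc k) m b"
  let ?D = "divided_power (2 * Suc k)"
  obtain K where K: "K \<ge> 0" "\<And>h m p q. h > 0 \<Longrightarrow> 0 \<le> p \<Longrightarrow> p + q = real m * h \<Longrightarrow>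
     real m * h \<le> T \<Longrightarrow> 0 < c\<^sub>1 * q - c\<^sub>2 * p \<Longrightarrow> \<bar>?U h m (c\<^sub>1 * q - c\<^sub>2 * p) - ?u p q\<bar> \<le> K * h"
    using up unfolding approximates_def by blast
  obtain L where L: "L \<ge> 0"
    "\<And>p p' q. p \<in> {0..T} \<Longrightarrow> q \<in> {0..T} \<Longrightarrow> p' \<in> {0..T} \<Longrightarrow> \<bar>?u p q - ?u p' q\<bar> \<le> L * \<bar>p - p'\<bar>"
    using lipschitz_square[OF lipschitz_volumes(1)] by metis
  obtain M where M: "M \<ge> 0"
    "\<And>p q q'. p \<in> {0..T} \<Longrightarrow> q \<in> {0..T} \<Longrightarrow> q' \<in> {0..T} \<Longrightarrow> \<bar>?v p q - ?v p q'\<bar> \<le> M * \<bar>q - q'\<bar>"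
    "\<And>p p' q. p \<in> {0..T} \<Longrightarrow> q \<in> {0..T} \<Longrightarrow> p' \<in> {0..T} \<Longrightarrow> \<bar>?v p q - ?v p' q\<bar> \<le> M * \<bar>p - p'\<bar>"
    using lipschitz_square[OF lipschitz_volumes(2)] by metis
  obtain B where B: "B \<ge> 0" "\<And>h m. 0 \<le> h \<Longrightarrow> real m * h \<le> T \<Longrightarrow>
     \<bar>h ^ (2 * Suc k) * real (m choose (2 * Suc k)) - ?D (real m * h)\<bar> \<le> B * h"
    using binomial_approx_divided_power[OF T] by blast
  let ?C = "B + 2 * M"
  have main: "\<bar>?V h m (c\<^sub>1 * q - c\<^sub>2 * p) - ?v p q\<bar> \<le> ((K + L) * (real m * h) + ?C) * h"
    if "h > 0" "0 \<le> p" "p + q = real m * h" "real m * h \<le> T" "0 < c\<^sub>1 * q - c\<^sub>2 * p" for h m p q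
    using that
  proof (induction m arbitrary: p q)
    case 0
    \<comment> \<open>no time remains: \<open>q = -p \<le> 0\<close> contradicts the position below the barrier\<close>
    then have "q \<le> 0" by simp
    then have "c\<^sub>1 * q \<le> 0" "0 \<le> c\<^sub>2 * p" using c 0 by (auto simp: mult_le_0_iff)
    then show ?case using 0 by linarith
  next
    case (Suc m)
    \<comment> \<open>below the barrier, \<open>p \<ge> 0\<close> forces \<open>q > 0\<close>, so \<open>(p, q)\<close> lies in the square \<open>[0, T]\<^sup>2\<close>\<close>
    have q: "0 < q"
      using Suc.prems(2,5) c by (smt (verit) mult_nonneg_nonneg mult_le_0_iff)
    have p: "p \<le> T" "q \<le> T" using Suc.prems q by auto
    let ?b = "c\<^sub>1 * q - c\<^sub>2 * (p - h)"
    have b: "?b = c\<^sub>1 * q - c\<^sub>2 * p + c\<^sub>2 * h" by (simp add: algebra_simps)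
    moreover have "0 < c\<^sub>2 * h" using Suc.prems(1) c by simp
    ultimately have b0: "0 < ?b" using Suc.prems(5) by linarith
    have mh: "(p - h) + q = real m * h" "real m * h \<le> T"
      using Suc.prems by (auto simp: algebra_simps)
    have rec: "?V h (Suc m) (c\<^sub>1 * q - c\<^sub>2 * p) = ?V h m ?b + h * ?U h m ?b"
      using scaled_count_Suc(2)[OF Suc.prems(5), of c\<^sub>1 c\<^sub>2 h "2*k+1" m]
      unfolding b[symmetric] by simp
    show ?case
    proof (cases "p < h")
      case True
      have "c\<^sub>1 * (p - h) < 0" "c\<^sub>2 * (p - h) < 0" using True c by (auto simp: mult_less_0_iff)
      then have "c\<^sub>1 * (real m * h) < ?b" unfolding mh(1)[symmetric] by (simp add: algebra_simps)
      then have "?V h (Suc m) (c\<^sub>1 * q - c\<^sub>2 * p) = h ^ (2 * Suc k) * real (Suc m choose (2 * Suc k))"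
        unfolding rec using c Suc.prems(1) by (simp add: scaled_count_free algebra_simps)
      moreover have "\<bar>h ^ (2 * Suc k) * real (Suc m choose (2 * Suc k)) - ?v 0 (p + q)\<bar> \<le> B * h"
        unfolding Suc.prems(3) down_volume_at_0 by (rule B(2)) (use Suc.prems in auto)
      moreover have "\<bar>?v 0 (p + q) - ?v 0 q\<bar> \<le> M * h"
      proof -
        have "\<bar>?v 0 (p + q) - ?v 0 q\<bar> \<le> M * \<bar>(p + q) - q\<bar>"
          by (rule M(2)) (use Suc.prems T q p in auto)
        also have "\<dots> \<le> M * h" using True Suc.prems M by (intro mult_left_mono) auto
        finally show ?thesis .
      qed
      moreover have "\<bar>?v 0 q - ?v p q\<bar> \<le> M * h"
      proof -
        have "\<bar>?v 0 q - ?v p q\<bar> \<le> M * \<bar>0 - p\<bar>"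
          by (rule M(3)) (use Suc.prems T q p in auto)
        also have "\<dots> \<le> M * h" using True Suc.prems M by (intro mult_left_mono) auto
        finally show ?thesis .
      qed
      moreover have "0 \<le> (K + L) * (real (Suc m) * h) * h" using K L Suc.prems by simp
      ultimately show ?thesis unfolding distrib_right[of "(K + L) * (real (Suc m) * h)"] by (simp add: algebra_simps del: of_nat_Suc)
    next
      case False
      have IH: "\<bar>?V h m ?b - ?v (p - h) q\<bar> \<le> ((K + L) * (real m * h) + ?C) * h"
        by (rule Suc.IH) (use False Suc.prems(1) b0 mh in auto)
      have U: "\<bar>?U h m ?b - ?u (p - h) q\<bar> \<le> K * h"
        by (rule K(2)) (use False Suc.prems(1) b0 mh in auto)
      obtain \<xi> where \<xi>: "p - h < \<xi>" "\<xi> < p" "?v p q - ?v (p - h) q = h * ?u \<xi> q"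
        using MVT2[of "p - h" p "\<lambda>p. ?v p q" "\<lambda>p. ?u p q"] down_volume_Suc_deriv Suc.prems(1) by force
      have "\<bar>?u \<xi> q - ?u (p - h) q\<bar> \<le> L * \<bar>\<xi> - (p - h)\<bar>"
        by (intro L(2)) (use p q False \<xi> Suc.prems(2) in auto)
      also have "\<dots> \<le> L * h" using \<xi> L by (intro mult_left_mono) auto
      finally have u: "\<bar>?u \<xi> q - ?u (p - h) q\<bar> \<le> L * h" .
      have "?V h (Suc m) (c\<^sub>1 * q - c\<^sub>2 * p) - ?v p q
         = (?V h m ?b - ?v (p - h) q) + h * ((?U h m ?b - ?u (p - h) q) - (?u \<xi> q - ?u (p - h) q))"
        unfolding rec using \<xi>(3) by (simp add: algebra_simps)
      also have "\<bar>\<dots>\<bar> \<le> ((K + L) * (real m * h) + ?C) * h + h * (K * h + L * h)"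
      proof -
        have "\<bar>h * ((?U h m ?b - ?u (p - h) q) - (?u \<xi> q - ?u (p - h) q))\<bar> \<le> h * (K * h + L * h)"
          unfolding abs_mult using U u Suc.prems(1) by (intro mult_mono) auto
        then show ?thesis using IH by linarith
      qed
      finally show ?thesis by (simp add: algebra_simps)
    qed
  qed
  show ?thesis unfolding approximates_def
  proof (intro exI[of _ "(K + L) * T + ?C"] conjI allI impI)
    show "0 \<le> (K + L) * T + ?C" using K L M B T by simp
    fix h :: real and m p q
    assume a: "0 < h" "0 \<le> p" "p + q = real m * h" "real m * h \<le> T" "0 < c\<^sub>1 * q - c\<^sub>2 * p"
    have "(K + L) * (real m * h) \<le> (K + L) * T" using K L a by (intro mult_left_mono) auto
    then have "((K + L) * (real m * h) + ?C) * h \<le> ((K + L) * T + ?C) * h"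
      using a by (intro mult_right_mono) auto
    then show "\<bar>?V h m (c\<^sub>1 * q - c\<^sub>2 * p) - ?v p q\<bar> \<le> ((K + L) * T + ?C) * h"
      using main[OF a] by linarith
  qed
qed

lemma scaled_count_approximates:
  assumes "0 < c\<^sub>1" "0 < c\<^sub>2" "0 \<le> T"
  shows "approximates c\<^sub>1 c\<^sub>2 T True (2*k+1) (up_volume (c\<^sub>2/c\<^sub>1) k)"
proof -
  have "approximates c\<^sub>1 c\<^sub>2 T False (2*k) (down_volume (c\<^sub>2/c\<^sub>1) k)"
  proof (induction k)
    case 0
    show ?case using assms unfolding approximates_def
      by (intro exI[of _ 0]) (simp add: scaled_count_no_jump)
  next
    case (Suc k)
    then show ?case using up_step down_step assms by blast
  qed
  then show ?thesis using up_step assms by blast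
qed

section \<open>Comparing a path with its grid walk\<close>
definition velocity :: "real \<Rightarrow> real \<Rightarrow> (real \<Rightarrow> nat) \<Rightarrow> real \<Rightarrow> real" where
  "velocity c\<^sub>1 c\<^sub>2 N s = (if even (N s) then c\<^sub>1 else - c\<^sub>2)"

definition position :: "real \<Rightarrow> real \<Rightarrow> (real \<Rightarrow> nat) \<Rightarrow> real \<Rightarrow> real" where
  "position c\<^sub>1 c\<^sub>2 N s = integral {0..s} (velocity c\<^sub>1 c\<^sub>2 N)"

text \<open>
  The velocity is an alternating sum of the increasing indicator functions of the events that more than
  \<open>j\<close> jumps have occurred.
\<close>
lemma velocity_integrable:
  assumes N: "mono_on {0..} N" and "0 \<le> a"
  shows "velocity c\<^sub>1 c\<^sub>2 N integrable_on {a..b}"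
proof -
  have "(\<lambda>s. c\<^sub>1 - (c\<^sub>1 + c\<^sub>2) * (\<Sum>j<N b. (- 1) ^ j * of_bool (j < N s))) integrable_on {a..b}"
    using assms
    by (intro integrable_diff integrable_const_ivl integrable_on_mult_right integrable_sum
        integrable_on_mono_on mono_onI) (auto intro: less_le_trans[OF _ mono_onD[OF N]])
  moreover have "velocity c\<^sub>1 c\<^sub>2 N s = c\<^sub>1 - (c\<^sub>1 + c\<^sub>2) * (\<Sum>j<N b. (- 1) ^ j * of_bool (j < N s))"
    if "s \<in> {a..b}" for s
  proof -
    have alt: "(\<Sum>j<n. (- 1) ^ j) = (of_bool (odd n) :: real)" for n by (induction n) auto
    have "N s \<le> N b" using that assms by (auto intro: mono_onD[OF N])
    then have "(\<Sum>j<N b. (- 1) ^ j * of_bool (j < N s)) = (\<Sum>j<N s. (- 1 :: real) ^ j)"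
      by (intro sum.mono_neutral_cong_right) auto
    then show ?thesis by (simp add: alt velocity_def)
  qed
  ultimately show ?thesis by (rule integrable_eq[OF _ sym])
qed

lemma position_diff:
  assumes "mono_on {0..} N" and "0 \<le> a" "a \<le> b"
  shows "position c\<^sub>1 c\<^sub>2 N b - position c\<^sub>1 c\<^sub>2 N a = integral {a..b} (velocity c\<^sub>1 c\<^sub>2 N)"
proof -
  have "integral {0..a} (velocity c\<^sub>1 c\<^sub>2 N) + integral {a..b} (velocity c\<^sub>1 c\<^sub>2 N)
      = integral {0..b} (velocity c\<^sub>1 c\<^sub>2 N)"
    using assms
    by (intro Henstock_Kurzweil_Integration.integral_combine velocity_integrable) auto
  then show ?thesis unfolding position_def by linarith
qed

lemma position_diff_bounds:
  assumes N: "mono_on {0..} N" and ab: "0 \<le> a" "a \<le> b" and c: "0 \<le> c\<^sub>1 + c\<^sub>2"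
  shows "position c\<^sub>1 c\<^sub>2 N b - position c\<^sub>1 c\<^sub>2 N a \<le> c\<^sub>1 * (b - a)"
    and "- c\<^sub>2 * (b - a) \<le> position c\<^sub>1 c\<^sub>2 N b - position c\<^sub>1 c\<^sub>2 N a"
proof -
  have "integral {a..b} (velocity c\<^sub>1 c\<^sub>2 N) \<le> integral {a..b} (\<lambda>_. c\<^sub>1)"
    by (intro integral_le velocity_integrable N ab) (use c in \<open>auto simp: velocity_def\<close>)
  then show "position c\<^sub>1 c\<^sub>2 N b - position c\<^sub>1 c\<^sub>2 N a \<le> c\<^sub>1 * (b - a)"
    unfolding position_diff[OF N ab] using ab by (simp add: mult.commute)
  have "integral {a..b} (\<lambda>_. - c\<^sub>2) \<le> integral {a..b} (velocity c\<^sub>1 c\<^sub>2 N)"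
    by (intro integral_le velocity_integrable N ab) (use c in \<open>auto simp: velocity_def\<close>)
  then show "- c\<^sub>2 * (b - a) \<le> position c\<^sub>1 c\<^sub>2 N b - position c\<^sub>1 c\<^sub>2 N a"
    unfolding position_diff[OF N ab] using ab by (simp add: mult.commute)
qed

lemma position_diff_no_jump:
  assumes N: "mono_on {0..} N" and ab: "0 \<le> a" "a \<le> b" and eq: "N b = N a"
  shows "position c\<^sub>1 c\<^sub>2 N b - position c\<^sub>1 c\<^sub>2 N a = velocity c\<^sub>1 c\<^sub>2 N a * (b - a)"
proof -
  have "velocity c\<^sub>1 c\<^sub>2 N s = velocity c\<^sub>1 c\<^sub>2 N a" if "s \<in> {a..b}" for s
  proof -
    have "N a \<le> N s" "N s \<le> N b" using that ab by (auto intro!: mono_onD[OF N])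
    then have "N s = N a" unfolding eq by (rule antisym[rotated])
    then show ?thesis by (simp only: velocity_def)
  qed
  then have "integral {a..b} (velocity c\<^sub>1 c\<^sub>2 N) = integral {a..b} (\<lambda>_. velocity c\<^sub>1 c\<^sub>2 N a)"
    by (rule integral_cong)
  then show ?thesis unfolding position_diff[OF N ab] using ab by (simp add: mult.commute)
qed

primrec grid_increments :: "(real \<Rightarrow> nat) \<Rightarrow> real \<Rightarrow> nat \<Rightarrow> real \<Rightarrow> nat list" where
  "grid_increments N h 0 a = []"
| "grid_increments N h (Suc m) a = (N (a + h) - N a) # grid_increments N h m (a + h)"

lemma grid_increments_eq_map:
  "grid_increments N h m a = map (\<lambda>i. N (a + real (Suc i) * h) - N (a + real i * h)) [0..<m]"
proof (induction m arbitrary: a)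
  case (Suc m)
  have "[0..<Suc m] = 0 # map Suc [0..<m]" by (simp add: upt_conv_Cons map_Suc_upt del: upt_Suc)
  then show ?case unfolding grid_increments.simps Suc.IH
    by (simp add: algebra_simps)
qed simp

lemma sum_list_grid_increments:
  assumes N: "mono_on {0..} N" and "0 \<le> a" "0 \<le> h"
  shows "sum_list (grid_increments N h m a) + N a = N (a + real m * h)"
  using \<open>0 \<le> a\<close>
proof (induction m arbitrary: a)
  case (Suc m)
  have "N a \<le> N (a + h)" using mono_onD[OF N] Suc.prems assms by auto
  moreover have "sum_list (grid_increments N h m (a + h)) + N (a + h) = N (a + h + real m * h)"
    using Suc.IH Suc.prems assms by simp
  ultimately show ?case by (simp add: algebra_simps)
qed simp

text \<open>
  In a cell without jumps the path and the grid walk move by the same amount.  In a cell with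
  jumps their displacements both lie in \<open>[- c\<^sub>2 h, c\<^sub>1 h]\<close>, so they separate by at most \<open>(c\<^sub>1 + c\<^sub>2) h\<close>.
  Lowering the starting point of the walk by this amount for every jump still to come keeps the
  walk below the path throughout; \<open>b\<close> is its distance from the barrier.
\<close>
lemma stays_below_if_position_less:
  assumes N: "mono_on {0..} N" and h: "0 \<le> h" and c: "0 \<le> c\<^sub>1" "0 \<le> c\<^sub>2" and "0 \<le> a"
    and "\<And>s. a \<le> s \<Longrightarrow> s \<le> a + real m * h \<Longrightarrow> position c\<^sub>1 c\<^sub>2 N s < \<beta>"
    and "\<beta> - position c\<^sub>1 c\<^sub>2 N a + (c\<^sub>1 + c\<^sub>2) * h * (real (N (a + real m * h)) - real (N a)) \<le> b"
  shows "stays_below (c\<^sub>1 * h) (c\<^sub>2 * h) (even (N a)) b (grid_increments N h m a)"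
  using assms(5-)
proof (induction m arbitrary: a b)
  case 0
  have "position c\<^sub>1 c\<^sub>2 N a < \<beta>" by (rule 0) auto
  then show ?case using 0(3) by simp
next
  case (Suc m)
  let ?X = "position c\<^sub>1 c\<^sub>2 N" and ?e = "a + real (Suc m) * h"
  have e: "a + h + real m * h = ?e" by (simp add: algebra_simps)
  have mh: "0 \<le> real m * h" using h by simp
  have ah: "N a \<le> N (a + h)" "N (a + h) \<le> N ?e"
    using Suc.prems(1) h mh by (auto intro!: mono_onD[OF N] simp: algebra_simps)
  have C: "0 \<le> (c\<^sub>1 + c\<^sub>2) * h" using c h by simp
  have Xa: "?X a < \<beta>" using Suc.prems(1) h mh by (intro Suc.prems(2)) (auto simp: algebra_simps)
  have "0 \<le> (c\<^sub>1 + c\<^sub>2) * h * (real (N ?e) - real (N a))" using ah by (intro mult_nonneg_nonneg[OF C]) auto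
  then have b: "0 < b" using Suc.prems(3) Xa by linarith
  let ?b = "if even (N a) then b - c\<^sub>1 * h else b + c\<^sub>2 * h"
  have next_b: "\<beta> - ?X (a + h) + (c\<^sub>1 + c\<^sub>2) * h * (real (N ?e) - real (N (a + h))) \<le> ?b"
  proof (cases "N (a + h) = N a")
    case True
    then show ?thesis
      using position_diff_no_jump[OF N Suc.prems(1), of "a + h" c\<^sub>1 c\<^sub>2] h Suc.prems(3)
      by (auto simp: velocity_def)
  next
    case False
    then have "real (N ?e) - real (N (a + h)) \<le> real (N ?e) - real (N a) - 1" using ah by simp
    then have "(c\<^sub>1 + c\<^sub>2) * h * (real (N ?e) - real (N (a + h)))
        \<le> (c\<^sub>1 + c\<^sub>2) * h * (real (N ?e) - real (N a) - 1)"
      using C by (rule mult_left_mono)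
    also have "\<dots> = (c\<^sub>1 + c\<^sub>2) * h * (real (N ?e) - real (N a)) - c\<^sub>1 * h - c\<^sub>2 * h"
      by (simp add: algebra_simps)
    finally have "\<beta> - ?X (a + h) + (c\<^sub>1 + c\<^sub>2) * h * (real (N ?e) - real (N (a + h))) \<le> b - c\<^sub>1 * h"
      using position_diff_bounds(2)[OF N Suc.prems(1), of "a + h" c\<^sub>1 c\<^sub>2] c h Suc.prems(3) by simp
    moreover have "b - c\<^sub>1 * h \<le> ?b"
    proof -
      have "0 \<le> c\<^sub>1 * h" "0 \<le> c\<^sub>2 * h" using c h by auto
      then have "b - c\<^sub>1 * h \<le> b + c\<^sub>2 * h" by linarith
      then show ?thesis by auto
    qed
    ultimately show ?thesis by linarith
  qed
  have "stays_below (c\<^sub>1 * h) (c\<^sub>2 * h) (even (N (a + h))) ?b (grid_increments N h m (a + h))"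
  proof (rule Suc.IH)
    show "0 \<le> a + h" using Suc.prems h by simp
    show "?X s < \<beta>" if "a + h \<le> s" "s \<le> a + h + real m * h" for s
      using that Suc.prems(2)[of s] h unfolding e by simp
  qed (use next_b in \<open>unfold e\<close>)
  moreover have "(even (N a) = even (N (a + h) - N a)) \<longleftrightarrow> even (N (a + h))"
    using ah by auto
  ultimately show ?case using b by (simp only: grid_increments.simps stays_below.simps simp_thms)
qed

text \<open>
  Conversely, a walk that starts above the path by the same amount stays above it.
\<close>
lemma position_less_if_stays_below:
  assumes N: "mono_on {0..} N" and h: "0 < h" and c: "0 \<le> c\<^sub>1" "0 \<le> c\<^sub>2" and "0 \<le> a"
    and "stays_below (c\<^sub>1 * h) (c\<^sub>2 * h) (even (N a)) b (grid_increments N h m a)"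
    and "b + (c\<^sub>1 + c\<^sub>2) * h * (real (N (a + real m * h)) - real (N a)) \<le> \<beta> - position c\<^sub>1 c\<^sub>2 N a"
    and "a \<le> s" "s \<le> a + real m * h"
  shows "position c\<^sub>1 c\<^sub>2 N s < \<beta>"
  using assms(5-9)
proof (induction m arbitrary: a b)
  case 0
  have "s = a" using 0(4,5) by (intro antisym) auto
  moreover have "0 < b" using 0(2) by (rule stays_below_pos)
  moreover have "b \<le> \<beta> - position c\<^sub>1 c\<^sub>2 N a" using 0(3) by simp
  ultimately have "position c\<^sub>1 c\<^sub>2 N a < \<beta>" by linarith
  then show ?case unfolding \<open>s = a\<close> .
next
  case (Suc m)
  let ?X = "position c\<^sub>1 c\<^sub>2 N" and ?e = "a + real (Suc m) * h"
  have e: "a + h + real m * h = ?e" by (simp add: algebra_simps)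
  have mh: "0 \<le> real m * h" using h by simp
  have ah: "N a \<le> N (a + h)" "N (a + h) \<le> N ?e"
    using Suc.prems(1) h mh by (auto intro!: mono_onD[OF N] simp: algebra_simps)
  have C: "0 \<le> (c\<^sub>1 + c\<^sub>2) * h" using c h by simp
  let ?b = "if even (N a) then b - c\<^sub>1 * h else b + c\<^sub>2 * h"
  have "(even (N a) = even (N (a + h) - N a)) \<longleftrightarrow> even (N (a + h))"
    using ah by auto
  then have b: "0 < b"
    and rest: "stays_below (c\<^sub>1 * h) (c\<^sub>2 * h) (even (N (a + h))) ?b (grid_increments N h m (a + h))"
    using Suc.prems(2) by (simp_all only: grid_increments.simps stays_below.simps simp_thms)
  have b': "0 < ?b" using rest by (rule stays_below_pos)
  have ch: "0 \<le> c\<^sub>1 * h" "0 \<le> c\<^sub>2 * h" using c h by auto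
  have D: "0 \<le> (c\<^sub>1 + c\<^sub>2) * h * (real (N ?e) - real (N (a + h)))"
    using ah by (intro mult_nonneg_nonneg[OF C]) auto
  have jump: "(c\<^sub>1 + c\<^sub>2) * h * (real (N ?e) - real (N (a + h))) + c\<^sub>1 * h + c\<^sub>2 * h
      \<le> (c\<^sub>1 + c\<^sub>2) * h * (real (N ?e) - real (N a))" if "N (a + h) \<noteq> N a"
  proof -
    have "real (N ?e) - real (N (a + h)) + 1 \<le> real (N ?e) - real (N a)" using ah that by simp
    then have "(c\<^sub>1 + c\<^sub>2) * h * (real (N ?e) - real (N (a + h)) + 1)
        \<le> (c\<^sub>1 + c\<^sub>2) * h * (real (N ?e) - real (N a))"
      using C by (rule mult_left_mono)
    then show ?thesis by (simp add: algebra_simps)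
  qed
  have next_b: "?b + (c\<^sub>1 + c\<^sub>2) * h * (real (N ?e) - real (N (a + h))) \<le> \<beta> - ?X (a + h)"
  proof (cases "N (a + h) = N a")
    case True
    then show ?thesis
      using position_diff_no_jump[OF N Suc.prems(1), of "a + h" c\<^sub>1 c\<^sub>2] h Suc.prems(3)
      by (auto simp: velocity_def)
  next
    case False
    have "?X (a + h) - ?X a \<le> c\<^sub>1 * h"
      using position_diff_bounds(1)[OF N Suc.prems(1), of "a + h" c\<^sub>1 c\<^sub>2] c h by simp
    moreover have "?b \<le> b + c\<^sub>2 * h" using ch by auto
    ultimately show ?thesis using jump[OF False] Suc.prems(3) by linarith
  qed
  show ?case
  proof (cases "s \<le> a + h")
    case False
    show ?thesis
    proof (rule Suc.IH[OF _ rest])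
      show "0 \<le> a + h" "a + h \<le> s" using False Suc.prems(1) h by simp_all
    qed (use next_b Suc.prems(5) in \<open>simp_all only: e\<close>)
  next
    case True
    have Xs: "?X s - ?X a \<le> c\<^sub>1 * (s - a)"
      using position_diff_bounds(1)[OF N Suc.prems(1,4), of c\<^sub>1 c\<^sub>2] c by simp
    have up: "c\<^sub>1 * (s - a) \<le> c\<^sub>1 * h" using True c by (intro mult_left_mono) auto
    show ?thesis
    proof (cases "N (a + h) = N a")
      case False
      then show ?thesis using jump[OF False] Suc.prems(3) Xs up D b ch by linarith
    next
      case True
      then have "N s = N a"
        using \<open>s \<le> a + h\<close> Suc.prems(1,4) h mono_onD[OF N, of a s] mono_onD[OF N, of s "a + h"] by auto
      then have Xs': "?X s - ?X a = velocity c\<^sub>1 c\<^sub>2 N a * (s - a)"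
        using position_diff_no_jump[OF N Suc.prems(1,4)] by simp
      have bound: "b \<le> \<beta> - ?X a" using Suc.prems(3) D True by simp
      show ?thesis
      proof (cases "even (N a)")
        case True
        then show ?thesis using b' bound Xs up by simp
      next
        case False
        have "0 \<le> c\<^sub>2 * (s - a)" using c Suc.prems(4) by simp
        then show ?thesis using False Xs' bound b by (simp add: velocity_def)
      qed
    qed
  qed
qed

lemma telegraph_position_eq:
  assumes "0 < c\<^sub>1" "0 < c\<^sub>2" "V0 \<omega> = c\<^sub>1"
  shows "telegraph_position c\<^sub>1 c\<^sub>2 V0 N s \<omega> = position c\<^sub>1 c\<^sub>2 (\<lambda>s. N s \<omega>) s"
proof -
  have "(switch_velocity c\<^sub>1 c\<^sub>2 ^^ n) c\<^sub>1 = (if even n then c\<^sub>1 else - c\<^sub>2)" for n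
    using assms by (induction n) (auto simp: switch_velocity_def)
  then have "telegraph_velocity c\<^sub>1 c\<^sub>2 V0 N s \<omega> = velocity c\<^sub>1 c\<^sub>2 (\<lambda>s. N s \<omega>) s" for s
    unfolding telegraph_velocity_def velocity_def assms(3) .
  then show ?thesis unfolding telegraph_position_def position_def by presburger
qed

lemma position_0 [simp]: "position c\<^sub>1 c\<^sub>2 N 0 = 0"
  by (simp add: position_def)

lemma bdd_above_position:
  assumes "mono_on {0..} N" and "0 \<le> c\<^sub>1" "0 \<le> c\<^sub>2"
  shows "bdd_above (position c\<^sub>1 c\<^sub>2 N ` {0..t})"
proof (rule bdd_aboveI2)
  fix s assume s: "s \<in> {0..t}"
  have "position c\<^sub>1 c\<^sub>2 N s \<le> c\<^sub>1 * s"
    using position_diff_bounds(1)[OF assms(1), of 0 s c\<^sub>1 c\<^sub>2] s assms by simp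
  also have "\<dots> \<le> c\<^sub>1 * t" using s assms by (intro mult_left_mono) auto
  finally show "position c\<^sub>1 c\<^sub>2 N s \<le> c\<^sub>1 * t" .
qed

text \<open>
  The separation after \<open>n\<close> jumps, in units of the mesh.  The additional \<open>1\<close> turns a bound for every
  single position into a strict bound for the supremum.
\<close>
definition grid_error :: "real \<Rightarrow> real \<Rightarrow> nat \<Rightarrow> real" where
  "grid_error c\<^sub>1 c\<^sub>2 n = (c\<^sub>1 + c\<^sub>2) * real n + 1"

lemma SUP_position_less_if_stays_below:
  assumes N: "mono_on {0..} N" "N 0 = 0" "N t = n" and h: "0 < h" "real m * h = t" and c: "0 \<le> c\<^sub>1" "0 \<le> c\<^sub>2"
    and "stays_below (c\<^sub>1 * h) (c\<^sub>2 * h) True (\<beta> - grid_error c\<^sub>1 c\<^sub>2 n * h)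
           (grid_increments N h m 0)"
  shows "(SUP s\<in>{0..t}. position c\<^sub>1 c\<^sub>2 N s) < \<beta>"
proof -
  have t: "0 \<le> t" using h by (metis less_imp_le mult_nonneg_nonneg of_nat_0_le_iff)
  have "(SUP s\<in>{0..t}. position c\<^sub>1 c\<^sub>2 N s) \<le> \<beta> - h"
  proof (rule cSUP_least)
    fix s assume s: "s \<in> {0..t}"
    have "position c\<^sub>1 c\<^sub>2 N s < \<beta> - h"
    proof (rule position_less_if_stays_below[OF N(1) h(1) c order.refl])
      show "stays_below (c\<^sub>1 * h) (c\<^sub>2 * h) (even (N 0)) (\<beta> - grid_error c\<^sub>1 c\<^sub>2 n * h) (grid_increments N h m 0)"
        using assms(8) N by simp
    qed (use s N h in \<open>auto simp: grid_error_def algebra_simps add_divide_distrib\<close>)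
    then show "position c\<^sub>1 c\<^sub>2 N s \<le> \<beta> - h" by simp
  qed (use t in auto)
  then show ?thesis using h(1) by linarith
qed

lemma stays_below_if_SUP_position_less:
  assumes N: "mono_on {0..} N" "N 0 = 0" "N t = n" and h: "0 < h" "real m * h = t" and c: "0 \<le> c\<^sub>1" "0 \<le> c\<^sub>2"
    and "(SUP s\<in>{0..t}. position c\<^sub>1 c\<^sub>2 N s) < \<beta>"
  shows "stays_below (c\<^sub>1 * h) (c\<^sub>2 * h) True (\<beta> + grid_error c\<^sub>1 c\<^sub>2 n * h)
           (grid_increments N h m 0)"
proof -
  have "stays_below (c\<^sub>1 * h) (c\<^sub>2 * h) (even (N 0)) (\<beta> + grid_error c\<^sub>1 c\<^sub>2 n * h) (grid_increments N h m 0)"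
  proof (rule stays_below_if_position_less[OF N(1) _ c order.refl])
    fix s assume "0 \<le> s" "s \<le> 0 + real m * h"
    then have "position c\<^sub>1 c\<^sub>2 N s \<le> (SUP s\<in>{0..t}. position c\<^sub>1 c\<^sub>2 N s)"
      using h by (intro cSUP_upper bdd_above_position N c) auto
    then show "position c\<^sub>1 c\<^sub>2 N s < \<beta>" using assms(8) by linarith
  qed (use N h in \<open>auto simp: grid_error_def algebra_simps add_divide_distrib\<close>)
  then show ?thesis using N by simp
qed

section \<open>The law of the grid increments\<close>
lemma measurable_count_space_binary:
  fixes F :: "'b::countable \<Rightarrow> 'c::countable \<Rightarrow> 'd"
  assumes "f \<in> measurable M (count_space UNIV)" "g \<in> measurable M (count_space UNIV)"
  shows "(\<lambda>\<omega>. F (f \<omega>) (g \<omega>)) \<in> measurable M (count_space UNIV)"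
  by (rule measurable_compose_countable[OF _ assms(1)], rule measurable_compose_countable[OF _ assms(2)]) simp

lemma grid_increments_measurable:
  fixes X :: "real \<Rightarrow> 'a \<Rightarrow> nat"
  assumes X: "\<And>s. 0 \<le> s \<Longrightarrow> X s \<in> measurable M (count_space UNIV)" and "0 \<le> h" "0 \<le> a"
  shows "(\<lambda>\<omega>. grid_increments (\<lambda>s. X s \<omega>) h m a) \<in> measurable M (count_space UNIV)"
  using \<open>0 \<le> a\<close>
proof (induction m arbitrary: a)
  case (Suc m)
  have "(\<lambda>\<omega>. X (a + h) \<omega> - X a \<omega>) \<in> measurable M (count_space UNIV)"
    using Suc.prems assms by (intro measurable_count_space_binary[where F=minus] X) auto
  moreover have "(\<lambda>\<omega>. grid_increments (\<lambda>s. X s \<omega>) h m (a + h)) \<in> measurable M (count_space UNIV)"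
    using Suc.prems assms by (intro Suc.IH) auto
  ultimately show ?case unfolding grid_increments.simps
    by (rule measurable_count_space_binary[where F=Cons])
qed simp

lemma prod_pmf_poisson:
  assumes "0 < \<mu>" and "set ys \<subseteq> {0, 1}"
  shows "(\<Prod>i<length ys. pmf (poisson_pmf \<mu>) (ys ! i)) = exp (- \<mu>) ^ length ys * \<mu> ^ sum_list ys"
  using assms(2)
proof (induction ys)
  case (Cons y ys)
  then show ?case using assms(1)
    by (auto simp: prod.lessThan_Suc_shift pmf_poisson simp del: prod.lessThan_Suc)
qed simp

locale telegraph = prob_space M for M :: "'a measure" +
  fixes c\<^sub>1 c\<^sub>2 lam t :: real and V0 :: "'a \<Rightarrow> real" and N :: "real \<Rightarrow> 'a \<Rightarrow> nat"
  assumes c: "0 < c\<^sub>1" "0 < c\<^sub>2" and lam: "0 < lam" and t: "0 < t"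
    and poisson: "poisson_process M lam N"
    and V0: "V0 \<in> borel_measurable M" and start: "\<P>(\<omega> in M. V0 \<omega> = c\<^sub>1) = 1/2"
    and indep: "indep_of_process M V0 N"
begin

lemma N_measurable: "0 \<le> s \<Longrightarrow> N s \<in> measurable M (count_space UNIV)"
  using poisson by (auto simp: poisson_process_def counting_process_def)

lemma N_path:
  assumes "\<omega> \<in> space M"
  shows "N 0 \<omega> = 0" and "mono_on {0..} (\<lambda>s. N s \<omega>)"
  using poisson assms by (auto simp: poisson_process_def counting_process_def)

lemma prob_increment:
  assumes "0 \<le> s" "s < u"
  shows "prob ((\<lambda>\<omega>. N u \<omega> - N s \<omega>) -` {x} \<inter> space M) = pmf (poisson_pmf (lam * (u - s))) x"
proof -
  have "(\<lambda>\<omega>. N u \<omega> - N s \<omega>) \<in> measurable M (count_space UNIV)"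
    using assms by (intro measurable_count_space_binary[where F=minus] N_measurable) auto
  then have "prob ((\<lambda>\<omega>. N u \<omega> - N s \<omega>) -` {x} \<inter> space M)
      = measure (distr M (count_space UNIV) (\<lambda>\<omega>. N u \<omega> - N s \<omega>)) {x}"
    by (simp add: measure_distr)
  also have "distr M (count_space UNIV) (\<lambda>\<omega>. N u \<omega> - N s \<omega>) = measure_pmf (poisson_pmf (lam * (u - s)))"
    using poisson assms unfolding poisson_process_def by blast
  finally show ?thesis by (simp add: pmf.rep_eq)
qed

definition mesh :: "nat \<Rightarrow> real" where "mesh m = t / real m"

lemma mesh_pos: "0 < m \<Longrightarrow> 0 < mesh m" and mesh_nonneg: "0 \<le> mesh m"
  and mesh_mult: "0 < m \<Longrightarrow> real m * mesh m = t" and mesh_1 [simp]: "mesh (Suc 0) = t"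
  using t by (auto simp: mesh_def)

lemma tendsto_mesh: "(\<lambda>m. K * mesh m) \<longlonglongrightarrow> 0"
  using lim_const_over_n[of "K * t"] by (simp add: mesh_def)

definition incr :: "nat \<Rightarrow> 'a \<Rightarrow> nat list" where
  "incr m \<omega> = grid_increments (\<lambda>s. N s \<omega>) (mesh m) m 0"

lemma incr_measurable [measurable]: "incr m \<in> measurable M (count_space UNIV)"
  unfolding incr_def[abs_def] by (intro grid_increments_measurable N_measurable mesh_nonneg) auto

lemma prob_incr:
  assumes m: "0 < m" and xs: "length xs = m"
  shows "\<P>(\<omega> in M. incr m \<omega> = xs) = (\<Prod>i<m. pmf (poisson_pmf (lam * mesh m)) (xs ! i))"
proof -
  define \<tau> where "\<tau> i = real i * mesh m" for i
  have h: "0 < mesh m" using m by (rule mesh_pos)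
  have "0 \<le> \<tau> 0" "strict_mono_on {..m} \<tau>"
    using h by (auto simp only: \<tau>_def intro!: strict_mono_onI mult_strict_right_mono)
  then have "indep_vars (\<lambda>_. count_space UNIV) (\<lambda>i \<omega>. N (\<tau> (Suc i)) \<omega> - N (\<tau> i) \<omega>) {..<m}"
    using poisson unfolding poisson_process_def by blast
  then have "prob (\<Inter>i\<in>{..<m}. (\<lambda>\<omega>. N (\<tau> (Suc i)) \<omega> - N (\<tau> i) \<omega>) -` {xs ! i} \<inter> space M)
     = (\<Prod>i<m. prob ((\<lambda>\<omega>. N (\<tau> (Suc i)) \<omega> - N (\<tau> i) \<omega>) -` {xs ! i} \<inter> space M))"
    using m by (intro indep_varsD_finite) auto
  also have "\<dots> = (\<Prod>i<m. pmf (poisson_pmf (lam * mesh m)) (xs ! i))"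
  proof (rule prod.cong[OF refl])
    fix i
    have "\<tau> (Suc i) - \<tau> i = mesh m" by (simp add: \<tau>_def algebra_simps)
    moreover have "0 \<le> \<tau> i" using h by (simp add: \<tau>_def)
    moreover have "\<tau> i < \<tau> (Suc i)" using h by (simp add: \<tau>_def algebra_simps)
    ultimately show "prob ((\<lambda>\<omega>. N (\<tau> (Suc i)) \<omega> - N (\<tau> i) \<omega>) -` {xs ! i} \<inter> space M)
      = pmf (poisson_pmf (lam * mesh m)) (xs ! i)"
      using prob_increment[of "\<tau> i" "\<tau> (Suc i)"] by simp
  qed
  also have "(\<Inter>i\<in>{..<m}. (\<lambda>\<omega>. N (\<tau> (Suc i)) \<omega> - N (\<tau> i) \<omega>) -` {xs ! i} \<inter> space M)
     = {\<omega> \<in> space M. incr m \<omega> = xs}"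
    using m xs by (auto simp: incr_def grid_increments_eq_map list_eq_iff_nth_eq \<tau>_def)
  finally show ?thesis .
qed

text \<open>
  Patterns without multiple jumps and with the same number of jumps are equally likely, so that
  probabilities reduce to counting.
\<close>
lemma prob_incr_jump_pattern:
  assumes m: "0 < m" and xs: "xs \<in> jump_patterns m n"
  shows "\<P>(\<omega> in M. incr m \<omega> = xs) = exp (- lam * t) * (lam * mesh m) ^ n"
proof -
  let ?\<mu> = "lam * mesh m"
  have "0 < ?\<mu>" using lam mesh_pos[OF m] by simp
  then have "\<P>(\<omega> in M. incr m \<omega> = xs) = exp (- ?\<mu>) ^ m * ?\<mu> ^ n"
    using xs m prob_incr[of m xs] prod_pmf_poisson[of ?\<mu> xs] by (auto simp: jump_patterns_def)
  also have "exp (- ?\<mu>) ^ m = exp (- lam * t)"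
    using mesh_mult[OF m] unfolding exp_of_nat_mult[symmetric] by (simp add: mult.left_commute)
  finally show ?thesis .
qed

text \<open>
  The grid increments depend on finitely many of the counts, hence they are measurable with respect to
  the \<open>\<sigma>\<close>-algebra of the whole process, which is independent of the initial velocity.
\<close>
lemma prob_start_incr:
  "\<P>(\<omega> in M. V0 \<omega> = c\<^sub>1 \<and> incr m \<omega> \<in> S) = 1/2 * \<P>(\<omega> in M. incr m \<omega> \<in> S)"
proof -
  let ?P = "Pi\<^sub>M {0..} (\<lambda>_::real. count_space (UNIV :: nat set))" and ?F = "\<lambda>\<omega>. \<lambda>s\<in>{0..}. N s \<omega>"
  have "(\<lambda>f. grid_increments (\<lambda>s. f s) (mesh m) m 0) \<in> measurable ?P (count_space UNIV)"
    using mesh_nonneg by (intro grid_increments_measurable) auto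
  then have "(\<lambda>f. grid_increments (\<lambda>s. f s) (mesh m) m 0) -` S \<inter> space ?P \<in> sets ?P"
    by (rule measurable_sets) auto
  then have "?F -` ((\<lambda>f. grid_increments (\<lambda>s. f s) (mesh m) m 0) -` S \<inter> space ?P) \<inter> space M
      \<in> sets (vimage_algebra (space M) ?F ?P)"
    by (rule in_vimage_algebra)
  moreover have "?F -` ((\<lambda>f. grid_increments (\<lambda>s. f s) (mesh m) m 0) -` S \<inter> space ?P) \<inter> space M
      = {\<omega> \<in> space M. incr m \<omega> \<in> S}"
    using mesh_nonneg[of m] by (auto simp: incr_def grid_increments_eq_map space_PiM cong: map_cong)
  moreover have "V0 -` {c\<^sub>1} \<inter> space M \<in> sets (vimage_algebra (space M) V0 borel)"
    by (rule in_vimage_algebra) simp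
  ultimately have "prob ((V0 -` {c\<^sub>1} \<inter> space M) \<inter> {\<omega> \<in> space M. incr m \<omega> \<in> S})
      = prob (V0 -` {c\<^sub>1} \<inter> space M) * \<P>(\<omega> in M. incr m \<omega> \<in> S)"
    using indep unfolding indep_of_process_def by (metis (no_types, lifting) indep_setD)
  moreover have "(V0 -` {c\<^sub>1} \<inter> space M) \<inter> {\<omega> \<in> space M. incr m \<omega> \<in> S} = {\<omega> \<in> space M. V0 \<omega> = c\<^sub>1 \<and> incr m \<omega> \<in> S}"
    and "V0 -` {c\<^sub>1} \<inter> space M = {\<omega> \<in> space M. V0 \<omega> = c\<^sub>1}" by auto
  ultimately show ?thesis using start by simp
qed

lemma prob_start_jump_patterns:
  assumes m: "0 < m" and S: "S \<subseteq> jump_patterns m n"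
  shows "\<P>(\<omega> in M. V0 \<omega> = c\<^sub>1 \<and> incr m \<omega> \<in> S)
     = 1/2 * exp (- lam * t) * lam ^ n * (mesh m ^ n * real (card S))"
proof -
  let ?D = "distr M (count_space UNIV) (incr m)"
  interpret D: prob_space ?D by (rule prob_space_distr) simp
  have D: "measure ?D A = \<P>(\<omega> in M. incr m \<omega> \<in> A)" for A
    by (subst measure_distr) (auto intro!: arg_cong[of _ _ prob])
  have pow: "(lam * mesh m) ^ n = lam ^ n * mesh m ^ n" by (rule power_mult_distrib)
  have "measure ?D S = (\<Sum>xs\<in>S. measure ?D {xs})"
    using finite_subset[OF S] by (intro D.finite_measure_eq_sum_singleton) auto
  also have "\<dots> = (\<Sum>xs\<in>S. exp (- lam * t) * (lam * mesh m) ^ n)"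
    unfolding D using prob_incr_jump_pattern[OF m] S by (intro sum.cong) auto
  finally show ?thesis unfolding prob_start_incr D
    by (simp add: pow)
qed

lemma prob_start_count:
  "\<P>(\<omega> in M. V0 \<omega> = c\<^sub>1 \<and> N t \<omega> = n) = 1/2 * exp (- lam * t) * lam ^ n * divided_power n t"
proof -
  have "{\<omega> \<in> space M. V0 \<omega> = c\<^sub>1 \<and> N t \<omega> = n} = {\<omega> \<in> space M. V0 \<omega> = c\<^sub>1 \<and> incr 1 \<omega> \<in> {[n]}}"
    using N_path(1) by (auto simp: incr_def)
  moreover have "\<P>(\<omega> in M. incr 1 \<omega> \<in> {[n]}) = pmf (poisson_pmf (lam * t)) n"
    using prob_incr[of 1 "[n]"] by simp
  ultimately show ?thesis using prob_start_incr[of 1 "{[n]}"] lam t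
    by (simp add: divided_power_def power_mult_distrib)
qed

lemma sum_list_incr:
  assumes "\<omega> \<in> space M" "0 < m" shows "sum_list (incr m \<omega>) = N t \<omega>"
  using sum_list_grid_increments[OF N_path(2)[OF assms(1)], of 0 "mesh m" m] N_path(1)[OF assms(1)]
    mesh_nonneg mesh_mult[OF assms(2)]
  by (simp add: incr_def)

section \<open>Refining the grid\<close>
definition max_below :: "nat \<Rightarrow> real \<Rightarrow> 'a set" where
  "max_below n \<beta> = {\<omega> \<in> space M. (SUP s\<in>{0..t}. telegraph_position c\<^sub>1 c\<^sub>2 V0 N s \<omega>) < \<beta>
      \<and> V0 \<omega> = c\<^sub>1 \<and> N t \<omega> = n}"

definition walk_below :: "nat \<Rightarrow> nat \<Rightarrow> real \<Rightarrow> 'a set" where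
  "walk_below n m b = {\<omega> \<in> space M. V0 \<omega> = c\<^sub>1 \<and> incr m \<omega> \<in>
      {xs. sum_list xs = n \<and> stays_below (c\<^sub>1 * mesh m) (c\<^sub>2 * mesh m) True b xs}}"

abbreviation err :: "nat \<Rightarrow> nat \<Rightarrow> real" where
  "err n m \<equiv> grid_error c\<^sub>1 c\<^sub>2 n * mesh m"

text \<open>
  The grid events that enclose \<open>max_below\<close>.  They are determined by the initial
  velocity and finitely many counts.
\<close>
lemma walk_below_subset_max_below:
  assumes "0 < m" shows "walk_below n m (\<beta> - err n m) \<subseteq> max_below n \<beta>"
proof
  fix \<omega> assume *: "\<omega> \<in> walk_below n m (\<beta> - err n m)"
  then have \<omega>: "\<omega> \<in> space M" "V0 \<omega> = c\<^sub>1" "N t \<omega> = n"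
    using sum_list_incr assms by (auto simp: walk_below_def)
  have "(SUP s\<in>{0..t}. position c\<^sub>1 c\<^sub>2 (\<lambda>s. N s \<omega>) s) < \<beta>"
    using * N_path[OF \<omega>(1)] \<omega>(3) mesh_pos[OF assms] mesh_mult[OF assms] c
    by (intro SUP_position_less_if_stays_below[where n=n and m=m and h="mesh m"]) (auto simp: walk_below_def incr_def)
  then show "\<omega> \<in> max_below n \<beta>"
    using \<omega> by (simp add: max_below_def telegraph_position_eq c)
qed

lemma max_below_subset_walk_below:
  assumes "0 < m" shows "max_below n \<beta> \<subseteq> walk_below n m (\<beta> + err n m)"
proof
  fix \<omega> assume *: "\<omega> \<in> max_below n \<beta>"
  then have \<omega>: "\<omega> \<in> space M" "V0 \<omega> = c\<^sub>1" "N t \<omega> = n" by (auto simp: max_below_def)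
  have "stays_below (c\<^sub>1 * mesh m) (c\<^sub>2 * mesh m) True (\<beta> + err n m) (incr m \<omega>)"
    unfolding incr_def
  proof (rule stays_below_if_SUP_position_less)
    show "(SUP s\<in>{0..t}. position c\<^sub>1 c\<^sub>2 (\<lambda>s. N s \<omega>) s) < \<beta>"
      using * \<omega> by (simp add: max_below_def telegraph_position_eq c)
  qed (use N_path[OF \<omega>(1)] \<omega> mesh_pos[OF assms] mesh_mult[OF assms] c in auto)
  then show "\<omega> \<in> walk_below n m (\<beta> + err n m)"
    using \<omega> sum_list_incr assms by (simp add: walk_below_def)
qed

lemma start_incr_sets: "{\<omega> \<in> space M. V0 \<omega> = c\<^sub>1 \<and> incr m \<omega> \<in> S} \<in> sets M"
proof -
  have [measurable]: "V0 \<in> borel_measurable M" by (rule V0)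
  show ?thesis by measurable
qed

lemma start_count_sets: "{\<omega> \<in> space M. V0 \<omega> = c\<^sub>1 \<and> N t \<omega> = n} \<in> sets M"
proof -
  have [measurable]: "V0 \<in> borel_measurable M" "N t \<in> measurable M (count_space UNIV)"
    using V0 N_measurable t by auto
  show ?thesis by measurable
qed

lemma walk_below_sets [simp]: "walk_below n m b \<in> sets M"
  unfolding walk_below_def by (rule start_incr_sets)

lemma err_tendsto_0: "(\<lambda>m. err n m) \<longlonglongrightarrow> 0"
  by (rule tendsto_mesh)

text \<open>
  The supremum over uncountably many times is measurable because the lower grid events exhaust
  \<open>max_below\<close> as the mesh tends to \<open>0\<close>: if the supremum is less than \<open>\<beta>\<close>, it is less than
  \<open>\<beta>\<close> minus twice the grid error for some grid.
\<close>
lemma max_below_sets: "max_below n \<beta> \<in> sets M"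
proof -
  have covered: "\<exists>m>0. \<omega> \<in> walk_below n m (\<beta> - err n m)" if *: "\<omega> \<in> max_below n \<beta>" for \<omega>
  proof -
    let ?S = "SUP s\<in>{0..t}. telegraph_position c\<^sub>1 c\<^sub>2 V0 N s \<omega>"
    have \<omega>: "?S < \<beta>" using * by (simp add: max_below_def)
    have "(\<lambda>m. \<beta> - 2 * err n m) \<longlonglongrightarrow> \<beta> - 2 * 0"
      by (intro tendsto_intros err_tendsto_0)
    then have "\<forall>\<^sub>F m in sequentially. ?S < \<beta> - 2 * err n m"
      using \<omega> by (auto intro: order_tendstoD)
    then have "\<forall>\<^sub>F m in sequentially. 0 < m \<and> ?S < \<beta> - 2 * err n m"
      using eventually_gt_at_top by (rule eventually_conj[rotated])
    then have "\<exists>m. 0 < m \<and> ?S < \<beta> - 2 * err n m"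
      by (rule eventually_happens'[OF sequentially_bot])
    then obtain m where m: "0 < m" "?S < \<beta> - 2 * err n m" by blast
    then have "\<omega> \<in> max_below n (\<beta> - 2 * err n m)" using * by (simp add: max_below_def)
    then have "\<omega> \<in> walk_below n m (\<beta> - 2 * err n m + err n m)"
      using max_below_subset_walk_below[OF m(1)] by blast
    moreover have "\<beta> - 2 * err n m + err n m = \<beta> - err n m" by linarith
    ultimately show ?thesis using m(1) by metis
  qed
  have "max_below n \<beta> = (\<Union>m\<in>{0<..}. walk_below n m (\<beta> - err n m))"
  proof (intro antisym UN_least)
    show "max_below n \<beta> \<subseteq> (\<Union>m\<in>{0<..}. walk_below n m (\<beta> - err n m))"
      using covered by auto
    show "walk_below n m (\<beta> - err n m) \<subseteq> max_below n \<beta>" if "m \<in> {0<..}" for m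
      using that by (intro walk_below_subset_max_below) simp
  qed
  moreover have "(\<Union>m\<in>{0<..}. walk_below n m (\<beta> - err n m)) \<in> sets M"
    by (intro sets.countable_UN'' walk_below_sets) auto
  ultimately show ?thesis by (simp only:)
qed

lemma prob_walk_below_ge:
  assumes m: "0 < m"
  shows "1/2 * exp (- lam * t) * lam ^ n * scaled_count c\<^sub>1 c\<^sub>2 (mesh m) True n m b
    \<le> prob (walk_below n m b)"
proof -
  let ?S = "{xs \<in> jump_patterns m n. stays_below (c\<^sub>1 * mesh m) (c\<^sub>2 * mesh m) True b xs}"
  have "1/2 * exp (- lam * t) * lam ^ n * scaled_count c\<^sub>1 c\<^sub>2 (mesh m) True n m b
      = \<P>(\<omega> in M. V0 \<omega> = c\<^sub>1 \<and> incr m \<omega> \<in> ?S)"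
    unfolding scaled_count_def by (rule prob_start_jump_patterns[OF m, symmetric]) auto
  also have "\<dots> \<le> prob (walk_below n m b)"
    by (rule finite_measure_mono[OF _ walk_below_sets]) (auto simp: walk_below_def jump_patterns_def)
  finally show ?thesis .
qed

text \<open>
  The last summand accounts for the patterns with several jumps in one cell.  Their probability is
  the one of having \<open>n\<close> jumps minus the one of the \<open>m choose n\<close> patterns without multiple jumps.
\<close>
lemma prob_walk_below_le:
  assumes m: "0 < m"
  shows "prob (walk_below n m b) \<le> 1/2 * exp (- lam * t) * lam ^ n *
     (scaled_count c\<^sub>1 c\<^sub>2 (mesh m) True n m b
       + (divided_power n t - mesh m ^ n * real (m choose n)))"
proof -
  let ?K = "1/2 * exp (- lam * t) * lam ^ n"
  let ?S = "{xs \<in> jump_patterns m n. stays_below (c\<^sub>1 * mesh m) (c\<^sub>2 * mesh m) True b xs}"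
  let ?A = "{\<omega> \<in> space M. V0 \<omega> = c\<^sub>1 \<and> incr m \<omega> \<in> ?S}"
  let ?B = "{\<omega> \<in> space M. V0 \<omega> = c\<^sub>1 \<and> N t \<omega> = n}"
  let ?C = "{\<omega> \<in> space M. V0 \<omega> = c\<^sub>1 \<and> incr m \<omega> \<in> jump_patterns m n}"
  have meas: "?A \<in> sets M" "?B \<in> sets M" "?C \<in> sets M"
    by (rule start_incr_sets start_count_sets)+
  have "walk_below n m b \<subseteq> ?A \<union> (?B - ?C)"
    using sum_list_incr[OF _ m] by (auto simp: walk_below_def jump_patterns_def)
  then have "prob (walk_below n m b) \<le> prob (?A \<union> (?B - ?C))"
    using meas by (intro finite_measure_mono) auto
  also have "\<dots> \<le> prob ?A + prob (?B - ?C)"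
    using meas by (intro measure_Un_le) auto
  also have "prob (?B - ?C) = prob ?B - prob ?C"
    using meas sum_list_incr[OF _ m] by (intro finite_measure_Diff) (auto simp: jump_patterns_def)
  also have "prob ?A + (prob ?B - prob ?C) = ?K * (scaled_count c\<^sub>1 c\<^sub>2 (mesh m) True n m b
       + (divided_power n t - mesh m ^ n * real (m choose n)))"
    unfolding prob_start_count prob_start_jump_patterns[OF m order.refl]
    by (subst prob_start_jump_patterns[OF m]) (auto simp: scaled_count_def card_jump_patterns algebra_simps)
  finally show ?thesis .
qed

text \<open>
  The volume for a start upwards at distance \<open>b\<close> from the barrier, in the coordinates \<open>p\<close> and \<open>q\<close>.
\<close>
definition limit_volume :: "nat \<Rightarrow> real \<Rightarrow> real" where
  "limit_volume k b = up_volume (c\<^sub>2 / c\<^sub>1) k ((c\<^sub>1 * t - b) / (c\<^sub>1 + c\<^sub>2)) ((c\<^sub>2 * t + b) / (c\<^sub>1 + c\<^sub>2))"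

lemma limit_volume_cont: "isCont (limit_volume k) b"
  unfolding limit_volume_def up_volume_def divided_power_def
  by (intro continuous_intros) (use c in auto)

lemma scaled_count_limit:
  assumes b: "b \<longlonglongrightarrow> \<beta>" and ev: "\<forall>\<^sub>F m in sequentially. 0 < b m \<and> b m \<le> c\<^sub>1 * t"
  shows "(\<lambda>m. scaled_count c\<^sub>1 c\<^sub>2 (mesh m) True (2*k+1) m (b m)) \<longlonglongrightarrow> limit_volume k \<beta>"
proof -
  obtain K where K: "\<And>h m p q. h > 0 \<Longrightarrow> 0 \<le> p \<Longrightarrow> p + q = real m * h \<Longrightarrow> real m * h \<le> t \<Longrightarrow>
      0 < c\<^sub>1 * q - c\<^sub>2 * p \<Longrightarrow> \<bar>scaled_count c\<^sub>1 c\<^sub>2 h True (2*k+1) m (c\<^sub>1 * q - c\<^sub>2 * p)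
        - up_volume (c\<^sub>2 / c\<^sub>1) k p q\<bar> \<le> K * h"
    using scaled_count_approximates[OF c less_imp_le[OF t], of k] unfolding approximates_def by blast
  have close: "\<bar>scaled_count c\<^sub>1 c\<^sub>2 (mesh m) True (2*k+1) m x - limit_volume k x\<bar> \<le> K * mesh m"
    if "0 < m" "0 < x" "x \<le> c\<^sub>1 * t" for m x
  proof -
    let ?p = "(c\<^sub>1 * t - x) / (c\<^sub>1 + c\<^sub>2)" and ?q = "(c\<^sub>2 * t + x) / (c\<^sub>1 + c\<^sub>2)"
    have cc: "c\<^sub>1 + c\<^sub>2 > 0" using c by simp
    have "c\<^sub>1 * ?q - c\<^sub>2 * ?p = (c\<^sub>1 * (c\<^sub>2 * t + x) - c\<^sub>2 * (c\<^sub>1 * t - x)) / (c\<^sub>1 + c\<^sub>2)"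
      by (simp only: times_divide_eq_right diff_divide_distrib[symmetric])
    also have "\<dots> = (c\<^sub>1 + c\<^sub>2) * x / (c\<^sub>1 + c\<^sub>2)" by (simp add: algebra_simps)
    finally have b: "c\<^sub>1 * ?q - c\<^sub>2 * ?p = x" using cc by simp
    have "?p + ?q = (c\<^sub>1 + c\<^sub>2) * t / (c\<^sub>1 + c\<^sub>2)"
      unfolding add_divide_distrib[symmetric] by (simp add: algebra_simps)
    then have pq: "?p + ?q = real m * mesh m" using cc mesh_mult[OF that(1)] by simp
    show ?thesis
      using K[of "mesh m" ?p ?q m] mesh_pos[OF that(1)] mesh_mult[OF that(1)] that cc pq
      unfolding b limit_volume_def by simp
  qed
  have "(\<lambda>m. scaled_count c\<^sub>1 c\<^sub>2 (mesh m) True (2*k+1) m (b m) - limit_volume k (b m)) \<longlonglongrightarrow> 0"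
  proof (rule Lim_null_comparison)
    show "\<forall>\<^sub>F m in sequentially. norm (scaled_count c\<^sub>1 c\<^sub>2 (mesh m) True (2*k+1) m (b m) - limit_volume k (b m))
       \<le> K * mesh m"
      using ev eventually_gt_at_top[of 0] by eventually_elim (simp only: real_norm_def close)
    show "(\<lambda>m. K * mesh m) \<longlonglongrightarrow> 0" by (rule tendsto_mesh)
  qed
  moreover have "(\<lambda>m. limit_volume k (b m)) \<longlonglongrightarrow> limit_volume k \<beta>"
    by (rule isCont_tendsto_compose[OF limit_volume_cont b])
  ultimately show ?thesis using tendsto_add by fastforce
qed

lemma choose_limit: "(\<lambda>m. divided_power n t - mesh m ^ n * real (m choose n)) \<longlonglongrightarrow> 0"
proof -
  obtain K where K: "\<And>h m. 0 \<le> h \<Longrightarrow> real m * h \<le> t \<Longrightarrow>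
     \<bar>h ^ n * real (m choose n) - divided_power n (real m * h)\<bar> \<le> K * h"
    using binomial_approx_divided_power[of t n] t by auto
  show ?thesis
  proof (rule Lim_null_comparison)
    show "\<forall>\<^sub>F m in sequentially. norm (divided_power n t - mesh m ^ n * real (m choose n)) \<le> K * mesh m"
      using eventually_gt_at_top[of 0]
    proof eventually_elim
      case (elim m)
      then show ?case using K[of "mesh m" m] mesh_nonneg[of m] mesh_mult[of m] by (simp add: abs_minus_commute)
    qed
    show "(\<lambda>m. K * mesh m) \<longlonglongrightarrow> 0" by (rule tendsto_mesh)
  qed
qed

lemma limit_volume_0: "limit_volume k 0 = 0"
  using up_volume_eq_0[of "c\<^sub>2 / c\<^sub>1" k "c\<^sub>1 * t / (c\<^sub>1 + c\<^sub>2)"] c by (simp add: limit_volume_def)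

text \<open>
  A barrier at \<open>c\<^sub>1 t\<close> corresponds to \<open>p = 0\<close>; it is reached only by a path without any downward
  movement.
\<close>
lemma limit_volume_top: "limit_volume k (c\<^sub>1 * t) = divided_power (2*k+1) t"
proof -
  have "(c\<^sub>2 * t + c\<^sub>1 * t) / (c\<^sub>1 + c\<^sub>2) = t" using c by (simp add: field_simps)
  moreover have "up_volume r k 0 q = divided_power (2*k+1) q" for r q
  proof -
    have "up_volume r k 0 q = (\<Sum>j\<in>{0}. divided_power j 0 * divided_power (2*k+1-j) q
      - r ^ (2*k+1-2*j) * divided_power (2*k+1-j) 0 * divided_power j q)"
      unfolding up_volume_def
      by (rule sum.mono_neutral_right) (auto simp: divided_power_def power_0_left)
    then show ?thesis by simp
  qed
  ultimately show ?thesis by (simp add: limit_volume_def)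
qed

text \<open>
  The approximation of the counts requires a shifted barrier in \<open>(0, c\<^sub>1 t]\<close>.  For small mesh this holds
  except for the upper bound at \<open>\<beta> = c\<^sub>1 t\<close> and the lower bound at \<open>\<beta> = 0\<close>, where the
  claims are the trivial bounds by the probability of \<open>2k + 1\<close> jumps and by \<open>0\<close>.
\<close>
lemma prob_max_below:
  assumes \<beta>: "\<beta> \<in> {0..c\<^sub>1 * t}"
  shows "prob (max_below (2*k+1) \<beta>) = 1/2 * exp (- lam * t) * lam ^ (2*k+1) * limit_volume k \<beta>"
proof (rule antisym)
  let ?n = "2*k+1" and ?C = "1/2 * exp (- lam * t) * lam ^ (2*k+1)"
  have e: "0 < err ?n m" if "0 < m" for m
    unfolding grid_error_def using c mesh_pos[OF that] by (intro mult_pos_pos add_nonneg_pos) auto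
  show "prob (max_below ?n \<beta>) \<le> ?C * limit_volume k \<beta>"
  proof (cases "\<beta> = c\<^sub>1 * t")
    case True
    have "prob (max_below ?n \<beta>) \<le> \<P>(\<omega> in M. V0 \<omega> = c\<^sub>1 \<and> N t \<omega> = ?n)"
      by (rule finite_measure_mono[OF _ start_count_sets]) (auto simp: max_below_def)
    then show ?thesis unfolding prob_start_count True limit_volume_top .
  next
    case False
    then have less: "\<beta> < c\<^sub>1 * t" using \<beta> by simp
    have lim: "(\<lambda>m. \<beta> + err ?n m) \<longlonglongrightarrow> \<beta>" using tendsto_add[OF tendsto_const err_tendsto_0] by simp
    have "\<forall>\<^sub>F m in sequentially. 0 < \<beta> + err ?n m \<and> \<beta> + err ?n m \<le> c\<^sub>1 * t"
      using order_tendstoD(2)[OF lim less] eventually_gt_at_top[of 0]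
    proof eventually_elim
      case (elim m)
      have "0 \<le> \<beta>" using \<beta> by simp
      with e[OF elim(2)] elim(1) show ?case by linarith
    qed
    then have upper: "(\<lambda>m. ?C * (scaled_count c\<^sub>1 c\<^sub>2 (mesh m) True ?n m (\<beta> + err ?n m)
       + (divided_power ?n t - mesh m ^ ?n * real (m choose ?n)))) \<longlonglongrightarrow> ?C * (limit_volume k \<beta> + 0)"
      by (intro tendsto_mult tendsto_add tendsto_const scaled_count_limit[OF lim] choose_limit)
    have "\<forall>\<^sub>F m in sequentially. prob (max_below ?n \<beta>) \<le>
      ?C * (scaled_count c\<^sub>1 c\<^sub>2 (mesh m) True ?n m (\<beta> + err ?n m)
       + (divided_power ?n t - mesh m ^ ?n * real (m choose ?n)))"
      using eventually_gt_at_top[of 0]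
    proof eventually_elim
      case (elim m)
      have "prob (max_below ?n \<beta>) \<le> prob (walk_below ?n m (\<beta> + err ?n m))"
        using max_below_subset_walk_below[OF elim] by (rule finite_measure_mono) simp
      then show ?case using prob_walk_below_le[OF elim] by (rule order.trans)
    qed
    then show ?thesis
      using tendsto_lowerbound[OF upper _ sequentially_bot] by (simp only: add_0_right)
  qed
  show "?C * limit_volume k \<beta> \<le> prob (max_below ?n \<beta>)"
  proof (cases "\<beta> = 0")
    case True
    then show ?thesis by (simp add: limit_volume_0)
  next
    case False
    then have less: "0 < \<beta>" using \<beta> by simp
    have lim: "(\<lambda>m. \<beta> - err ?n m) \<longlonglongrightarrow> \<beta>" using tendsto_diff[OF tendsto_const err_tendsto_0] by simp
    have "\<forall>\<^sub>F m in sequentially. 0 < \<beta> - err ?n m \<and> \<beta> - err ?n m \<le> c\<^sub>1 * t"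
      using order_tendstoD(1)[OF lim less] eventually_gt_at_top[of 0]
    proof eventually_elim
      case (elim m)
      have "\<beta> \<le> c\<^sub>1 * t" using \<beta> by simp
      with e[OF elim(2)] elim(1) show ?case by linarith
    qed
    then have lower: "(\<lambda>m. ?C * scaled_count c\<^sub>1 c\<^sub>2 (mesh m) True ?n m (\<beta> - err ?n m)) \<longlonglongrightarrow> ?C * limit_volume k \<beta>"
      by (intro tendsto_mult tendsto_const scaled_count_limit[OF lim])
    have "\<forall>\<^sub>F m in sequentially. ?C * scaled_count c\<^sub>1 c\<^sub>2 (mesh m) True ?n m (\<beta> - err ?n m)
        \<le> prob (max_below ?n \<beta>)"
      using eventually_gt_at_top[of 0]
    proof eventually_elim
      case (elim m)
      have "prob (walk_below ?n m (\<beta> - err ?n m)) \<le> prob (max_below ?n \<beta>)"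
        using walk_below_subset_max_below[OF elim] max_below_sets by (rule finite_measure_mono)
      then show ?case using prob_walk_below_ge[OF elim] by (rule order.trans[rotated])
    qed
    then show ?thesis
      by (rule tendsto_upperbound[OF lower _ sequentially_bot])
  qed
qed

text \<open>
  The factorials in the volume combine with the volume of the whole simplex to binomial coefficients.
\<close>
lemma limit_volume_eq:
  "limit_volume k \<beta> = divided_power (2*k+1) t *
    (\<Sum>j=0..k. real ((2 * k + 1) choose j) *
       (((c\<^sub>1 * t - \<beta>) ^ j * (c\<^sub>2 * t + \<beta>) ^ (2 * k + 1 - j)
         - (c\<^sub>2 / c\<^sub>1) ^ (2 * k + 1 - 2 * j) * (c\<^sub>1 * t - \<beta>) ^ (2 * k + 1 - j) * (c\<^sub>2 * t + \<beta>) ^ j)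
        / ((c\<^sub>1 + c\<^sub>2) * t) ^ (2 * k + 1)))"
proof -
  let ?n = "2*k+1" and ?C = "c\<^sub>1 + c\<^sub>2"
  have summand: "divided_power j (p / ?C) * divided_power (?n - j) (q / ?C)
      - r * divided_power (?n - j) (p / ?C) * divided_power j (q / ?C)
    = divided_power ?n t * (real (?n choose j) * ((p ^ j * q ^ (?n - j) - r * p ^ (?n - j) * q ^ j) / (?C * t) ^ ?n))"
    if "j \<le> ?n" for j p q r
  proof -
    have C: "?C ^ ?n = ?C ^ j * ?C ^ (?n - j)" using that by (simp flip: power_add)
    have cancel: "a / f * (f / g * (X / (d * a))) = X / (g * d)" if "a \<noteq> 0" "f \<noteq> 0" for a d f g X :: real
      using that by simp
    have E: "divided_power ?n t * (real (?n choose j) * (X / (?C * t) ^ ?n)) = X / (fact j * fact (?n - j) * ?C ^ ?n)" for X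
      unfolding divided_power_def binomial_fact[OF that] power_mult_distrib
      using t by (intro cancel) auto
    show ?thesis
      unfolding E unfolding C divided_power_def power_divide by (simp add: diff_divide_distrib mult_ac)
  qed
  show ?thesis unfolding limit_volume_def up_volume_def sum_distrib_left atMost_atLeast0
    by (intro sum.cong refl summand) auto
qed

end

theorem theorem2p2:
  fixes M :: "'a measure"
    and c\<^sub>1 c\<^sub>2 lam t \<beta> :: real
    and V0 :: "'a \<Rightarrow> real"
    and N :: "real \<Rightarrow> 'a \<Rightarrow> nat"
    and k :: nat
  assumes "prob_space M"
    and "0 < c\<^sub>1" and "0 < c\<^sub>2" and "0 < lam"
    and "poisson_process M lam N"
    and "V0 \<in> borel_measurable M"
    and "\<P>(\<omega> in M. V0 \<omega> = c\<^sub>1) = 1/2"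
    and "\<P>(\<omega> in M. V0 \<omega> = - c\<^sub>2) = 1/2"
    and "indep_of_process M V0 N"
    and "0 < t" and "\<beta> \<in> {0..c\<^sub>1 * t}"
  shows "\<P>(\<omega> in M. (SUP s\<in>{0..t}. telegraph_position c\<^sub>1 c\<^sub>2 V0 N s \<omega>) < \<beta>
             \<bar> V0 \<omega> = c\<^sub>1 \<and> N t \<omega> = 2 * k + 1) =
    (\<Sum>j=0..k. real ((2 * k + 1) choose j) *
       (((c\<^sub>1 * t - \<beta>) ^ j * (c\<^sub>2 * t + \<beta>) ^ (2 * k + 1 - j)
         - (c\<^sub>2 / c\<^sub>1) ^ (2 * k + 1 - 2 * j) * (c\<^sub>1 * t - \<beta>) ^ (2 * k + 1 - j) * (c\<^sub>2 * t + \<beta>) ^ j)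
        / ((c\<^sub>1 + c\<^sub>2) * t) ^ (2 * k + 1)))"
proof -
  interpret prob_space M by (rule assms(1))
  interpret telegraph M c\<^sub>1 c\<^sub>2 lam t V0 N
    using assms by unfold_locales auto
  have "divided_power (2*k+1) t \<noteq> 0" using t by (simp add: divided_power_def)
  then show ?thesis
    using prob_max_below[OF assms(11), of k] lam
    unfolding cond_prob_def prob_start_count max_below_def limit_volume_eq by simp
qed

end
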